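(* Let $f(z,w)=\left((1-2z/w)^2,(1-2/w)^2\right)$ on $\mathbb{P}\mathbb{C}^2$, and assume that $f$ is sub-hyperbolic. For $w_0\in\widehat{\mathbb{C}}$, the intersection $J_{w_0}$ of the Julia set of $f$ with the line $w=w_0$ is homeomorphic to a finite tree if and only if $w_0$ is mapped onto the fixed point $1$ by some iteration of $\widehat f(w)=(1-2/w)^2$.
   Context: In homogeneous coordinates $f[z:w:u]=[(w-2z)^2:(w-2u)^2:w^2]$; the line $w=w_0$ is the set of points $[z:w:u]$ with $[w:u]=w_0\in\widehat{\mathbb{C}}$. The Julia set $J$ of $f$ is the complement of the basin of attraction of the superattracting fixed point $[1:0:0]$. A finite tree means a finite simplicial tree. Sub-hyperbolic (the paper's standing conjectural assumption): there exists an orbispace metric on $\mathbb{P}\mathbb{C}^2\setminus\{[1:0:0]\}$ (a metric compatible with an orbispace structure whose singular locus lies in the post-critical set $\{z=0\}\cup\{z=u\}\cup\{z=w\}\cup\{w=0\}\cup\{w=u\}\cup\{u=0\}$ and for which $f$ is a covering of orbispaces) such that $f$ is uniformly expanding with respect to this metric on a neighborhood of $J$. *)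

theory Defs
  imports "HOL-Analysis.Analysis"
begin

section \<open>Complex projective spaces\<close>

text \<open>The type \<open>'n cproj\<close> is the projectivisation of \<open>complex ^ 'n\<close>: thus \<open>2 cproj\<close> is the
  Riemann sphere and \<open>3 cproj\<close> is the complex projective plane.\<close>

quotient_type (overloaded) 'n cproj =
  "complex ^ ('n::finite)" / partial: "\<lambda>v w. v \<noteq> 0 \<and> w \<noteq> 0 \<and> (\<exists>c. c \<noteq> 0 \<and> w = c *s v)"
proof (rule part_equivpI)
  let ?R = "\<lambda>v w :: complex^'n. v \<noteq> 0 \<and> w \<noteq> 0 \<and> (\<exists>c. c \<noteq> 0 \<and> w = c *s v)"
  show "\<exists>x. ?R x x"
    by (rule exI[of _ 1]) (auto intro!: exI[of _ 1] simp: vec_eq_iff)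
  show "symp ?R"
  proof (rule sympI)
    fix v w :: "complex^'n"
    assume R: "?R v w"
    then obtain c where "c \<noteq> 0" "w = c *s v" by blast
    then have "inverse c \<noteq> 0 \<and> v = inverse c *s w" by (simp add: vec_eq_iff)
    with R show "?R w v" by blast
  qed
  show "transp ?R"
  proof (rule transpI)
    fix u v w :: "complex^'n"
    assume R: "?R u v" "?R v w"
    then obtain c d where "c \<noteq> 0" "v = c *s u" "d \<noteq> 0" "w = d *s v" by blast
    then have "d * c \<noteq> 0 \<and> w = (d * c) *s u" by (simp add: vec_eq_iff)
    with R show "?R u w" by blast
  qed
qed

text \<open>The quotient topology inherited from the nonzero vectors.\<close>

instantiation cproj :: (finite) topological_space
begin

definition open_cproj :: "'a cproj set \<Rightarrow> bool" where
  "open_cproj U \<longleftrightarrow> open {v :: complex^'a. v \<noteq> 0 \<and> abs_cproj v \<in> U}"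

instance
proof
  have "{v :: complex^'a. v \<noteq> 0 \<and> abs_cproj v \<in> UNIV} = - {0}" by auto
  then show "open (UNIV :: 'a cproj set)" by (simp add: open_cproj_def open_Compl)
next
  fix S T :: "'a cproj set"
  assume "open S" "open T"
  then have "open ({v. v \<noteq> 0 \<and> abs_cproj v \<in> S} \<inter> {v. v \<noteq> 0 \<and> abs_cproj v \<in> T})"
    unfolding open_cproj_def by (rule open_Int)
  also have "{v. v \<noteq> 0 \<and> abs_cproj v \<in> S} \<inter> {v. v \<noteq> 0 \<and> abs_cproj v \<in> T}
      = {v. v \<noteq> 0 \<and> abs_cproj v \<in> S \<inter> T}" by auto
  finally show "open (S \<inter> T)" by (simp add: open_cproj_def)
next
  fix K :: "'a cproj set set"
  assume "\<forall>S\<in>K. open S"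
  then have "open (\<Union>S\<in>K. {v. v \<noteq> 0 \<and> abs_cproj v \<in> S})"
    by (intro open_UN) (auto simp: open_cproj_def)
  also have "(\<Union>S\<in>K. {v. v \<noteq> 0 \<and> abs_cproj v \<in> S}) = {v. v \<noteq> 0 \<and> abs_cproj v \<in> \<Union>K}" by auto
  finally show "open (\<Union>K)" by (simp add: open_cproj_def)
qed

end

text \<open>Points in homogeneous coordinates; meaningful only if not all coordinates vanish.\<close>

definition pt2 :: "complex \<Rightarrow> complex \<Rightarrow> 2 cproj" where
  "pt2 w u = abs_cproj (vector [w, u])"

definition pt3 :: "complex \<Rightarrow> complex \<Rightarrow> complex \<Rightarrow> 3 cproj" where
  "pt3 z w u = abs_cproj (vector [z, w, u])"


section \<open>The endomorphism of the plane and its Julia set\<close>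

lift_definition f_map :: "3 cproj \<Rightarrow> 3 cproj" is
  "\<lambda>v. vector [(v$2 - 2 * v$1)^2, (v$2 - 2 * v$3)^2, (v$2)^2]"
proof (elim conjE exE)
  fix v w :: "complex^3" and c :: complex
  assume v: "v \<noteq> 0" and w: "w \<noteq> 0" and c: "c \<noteq> 0" "w = c *s v"
  let ?F = "\<lambda>v::complex^3. vector [(v$2 - 2 * v$1)^2, (v$2 - 2 * v$3)^2, (v$2)^2] :: complex^3"
  have nz: "?F x \<noteq> 0" if "x \<noteq> 0" for x
    using that by (auto simp: vec_eq_iff forall_3)
  have "?F w = c\<^sup>2 *s ?F v"
    unfolding c by (simp add: vec_eq_iff forall_3 power2_eq_square algebra_simps)
  then show "?F v \<noteq> 0 \<and> ?F w \<noteq> 0 \<and> (\<exists>c. c \<noteq> 0 \<and> ?F w = c *s ?F v)"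
    using nz[OF v] nz[OF w] c by (auto intro!: exI[of _ "c\<^sup>2"])
qed

lift_definition fhat :: "2 cproj \<Rightarrow> 2 cproj" is
  "\<lambda>v. vector [(v$1 - 2 * v$2)^2, (v$1)^2]"
proof (elim conjE exE)
  fix v w :: "complex^2" and c :: complex
  assume v: "v \<noteq> 0" and w: "w \<noteq> 0" and c: "c \<noteq> 0" "w = c *s v"
  let ?F = "\<lambda>v::complex^2. vector [(v$1 - 2 * v$2)^2, (v$1)^2] :: complex^2"
  have nz: "?F x \<noteq> 0" if "x \<noteq> 0" for x
    using that by (auto simp: vec_eq_iff forall_2)
  have "?F w = c\<^sup>2 *s ?F v"
    unfolding c by (simp add: vec_eq_iff forall_2 power2_eq_square algebra_simps)
  then show "?F v \<noteq> 0 \<and> ?F w \<noteq> 0 \<and> (\<exists>c. c \<noteq> 0 \<and> ?F w = c *s ?F v)"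
    using nz[OF v] nz[OF w] c by (auto intro!: exI[of _ "c\<^sup>2"])
qed

lemma abs_cproj_eq_iff:
  fixes v w :: "complex ^ ('n::finite)"
  assumes "v \<noteq> 0" "w \<noteq> 0"
  shows "abs_cproj v = abs_cproj w \<longleftrightarrow> (\<exists>c. c \<noteq> 0 \<and> w = c *s v)"
proof -
  have refl: "\<exists>c. c \<noteq> 0 \<and> x = c *s x" for x :: "complex ^ 'n"
    by (auto intro!: exI[of _ 1] simp: vec_eq_iff)
  show ?thesis
    using Quotient_rel[OF Quotient_cproj, of v w] assms refl[of v] refl[of w] by simp
qed

lemma pt2_eq_iff:
  assumes "(w, u) \<noteq> (0, 0)" "(w', u') \<noteq> (0, 0)"
  shows "pt2 w u = pt2 w' u' \<longleftrightarrow> (\<exists>c. c \<noteq> 0 \<and> w' = c * w \<and> u' = c * u)"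
  unfolding pt2_def using assms
  by (subst abs_cproj_eq_iff) (auto simp: vec_eq_iff forall_2)

lemma pt3_eq_iff:
  assumes "(z, w, u) \<noteq> (0, 0, 0)" "(z', w', u') \<noteq> (0, 0, 0)"
  shows "pt3 z w u = pt3 z' w' u' \<longleftrightarrow> (\<exists>c. c \<noteq> 0 \<and> z' = c * z \<and> w' = c * w \<and> u' = c * u)"
  unfolding pt3_def using assms
  by (subst abs_cproj_eq_iff) (auto simp: vec_eq_iff forall_3)

lemma f_map_pt3:
  assumes "(z, w, u) \<noteq> (0, 0, 0)"
  shows "f_map (pt3 z w u) = pt3 ((w - 2 * z)^2) ((w - 2 * u)^2) (w^2)"
proof -
  have "vector [z, w, u] \<noteq> (0 :: complex^3) \<and> vector [z, w, u] \<noteq> (0 :: complex^3) \<and>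
      (\<exists>c. c \<noteq> 0 \<and> vector [z, w, u] = c *s (vector [z, w, u] :: complex^3))"
    using assms by (auto intro!: exI[of _ 1] simp: vec_eq_iff forall_3)
  then show ?thesis unfolding pt3_def by (subst f_map.abs_eq) simp_all
qed

lemma fhat_pt2:
  assumes "(w, u) \<noteq> (0, 0)"
  shows "fhat (pt2 w u) = pt2 ((w - 2 * u)^2) (w^2)"
proof -
  have "vector [w, u] \<noteq> (0 :: complex^2) \<and> vector [w, u] \<noteq> (0 :: complex^2) \<and>
      (\<exists>c. c \<noteq> 0 \<and> vector [w, u] = c *s (vector [w, u] :: complex^2))"
    using assms by (auto intro!: exI[of _ 1] simp: vec_eq_iff forall_2)
  then show ?thesis unfolding pt2_def by (subst fhat.abs_eq) simp_all
qed

lemma f_map_affine: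
  assumes "w \<noteq> 0"
  shows "f_map (pt3 z w 1) = pt3 ((1 - 2 * z / w)^2) ((1 - 2 / w)^2) 1"
  using assms
  by (subst f_map_pt3, simp, subst pt3_eq_iff)
     (auto intro!: exI[of _ "inverse (w^2)"] simp: field_simps power2_eq_square)

lemma fhat_affine:
  assumes "w \<noteq> 0"
  shows "fhat (pt2 w 1) = pt2 ((1 - 2 / w)^2) 1"
  using assms
  by (subst fhat_pt2, simp, subst pt2_eq_iff)
     (auto intro!: exI[of _ "inverse (w^2)"] simp: field_simps power2_eq_square)

definition basin :: "3 cproj set" where
  "basin = {p. (\<lambda>n. (f_map ^^ n) p) \<longlonglongrightarrow> pt3 1 0 0}"

definition julia :: "3 cproj set" where
  "julia = - basin"

definition wline :: "2 cproj \<Rightarrow> 3 cproj set" where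
  "wline w0 = {p. \<exists>z w u. (w, u) \<noteq> (0, 0) \<and> p = pt3 z w u \<and> pt2 w u = w0}"

definition postcritical :: "3 cproj set" where
  "postcritical = {p. \<exists>z w u. (z, w, u) \<noteq> (0, 0, 0) \<and> p = pt3 z w u \<and>
     (z = 0 \<or> z = u \<or> z = w \<or> w = 0 \<or> w = u \<or> u = 0)}"


section \<open>Finite trees\<close>

text \<open>A simplicial complex in a Euclidean space all of whose simplices are vertices or edges, and
  whose underlying graph is a tree.  Note that \<^const>\<open>simplicial_complex\<close> counts the empty set as
  a simplex.\<close>

definition cx_vertices :: "'a::euclidean_space set set \<Rightarrow> 'a set" where
  "cx_vertices K = {v. {v} \<in> K}"

definition cx_adj :: "'a::euclidean_space set set \<Rightarrow> ('a \<times> 'a) set" where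
  "cx_adj K = {(v, w). v \<noteq> w \<and> closed_segment v w \<in> K}"

definition simplicial_tree :: "'a::euclidean_space set set \<Rightarrow> bool" where
  "simplicial_tree K \<longleftrightarrow>
     simplicial_complex K \<and> (\<forall>S\<in>K. aff_dim S \<le> 1) \<and>
     cx_vertices K \<noteq> {} \<and>
     (\<forall>v\<in>cx_vertices K. \<forall>w\<in>cx_vertices K. (v, w) \<in> (cx_adj K)\<^sup>*) \<and>
     \<not> (\<exists>vs. length vs \<ge> 3 \<and> distinct vs \<and>
          (\<forall>i<length vs. (vs ! i, vs ! (Suc i mod length vs)) \<in> cx_adj K))"

text \<open>Every finite simplicial complex of dimension at most one can be realised in \<open>\<real>\<^sup>3\<close>, so fixing
  the ambient space is no restriction.\<close>

definition homeomorphic_to_finite_tree :: "'x::topological_space set \<Rightarrow> bool" where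
  "homeomorphic_to_finite_tree S \<longleftrightarrow>
     (\<exists>K :: (real^3) set set. simplicial_tree K \<and> S homeomorphic \<Union>K)"


section \<open>Orbispaces\<close>

text \<open>An orbispace is presented by an atlas: a topological space \<open>chart_top\<close> (thought of as the
  disjoint union of the charts), a pseudogroup \<open>chart_pgroup\<close> of partial homeomorphisms of it (the
  transition maps and the local symmetries), represented by their graphs, and the projection
  \<open>chart_proj\<close> onto the underlying space.  Locally the pseudogroup is a finite group, and the
  underlying space is the space of orbits.\<close>

record ('c, 'x) orbispace =
  chart_top :: "'c topology"
  chart_pgroup :: "('c \<times> 'c) set set"
  chart_proj :: "'c \<Rightarrow> 'x"

definition partial_homeo :: "'c topology \<Rightarrow> ('c \<times> 'c) set \<Rightarrow> bool" where
  "partial_homeo T r \<longleftrightarrow>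
     r \<subseteq> topspace T \<times> topspace T \<and> single_valued r \<and> single_valued (r\<inverse>) \<and>
     (\<forall>W. openin T W \<longrightarrow> openin T (r `` W) \<and> openin T (r\<inverse> `` W))"

definition pseudogroup :: "'c topology \<Rightarrow> ('c \<times> 'c) set set \<Rightarrow> bool" where
  "pseudogroup T H \<longleftrightarrow>
     (\<forall>r\<in>H. partial_homeo T r) \<and>
     Id_on (topspace T) \<in> H \<and>
     (\<forall>r\<in>H. \<forall>s\<in>H. r O s \<in> H) \<and>
     (\<forall>r\<in>H. r\<inverse> \<in> H) \<and>
     (\<forall>r\<in>H. \<forall>W. openin T W \<longrightarrow> r \<inter> (W \<times> UNIV) \<in> H) \<and>
     (\<forall>R. R \<subseteq> H \<and> single_valued (\<Union>R) \<and> single_valued ((\<Union>R)\<inverse>) \<longrightarrow> \<Union>R \<in> H)"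

definition germ_eq :: "'c topology \<Rightarrow> 'c \<Rightarrow> ('c \<times> 'c) set \<Rightarrow> ('c \<times> 'c) set \<Rightarrow> bool" where
  "germ_eq T a r s \<longleftrightarrow> (\<exists>N. openin T N \<and> a \<in> N \<and> r \<inter> (N \<times> UNIV) = s \<inter> (N \<times> UNIV))"

text \<open>\<open>G\<close> is a finite group of homeomorphisms of the open set \<open>W\<close>, and the restriction of the
  pseudogroup to \<open>W\<close> is generated by \<open>G\<close>.\<close>

definition uniformizing_chart ::
    "('c, 'x) orbispace \<Rightarrow> 'c set \<Rightarrow> ('c \<times> 'c) set set \<Rightarrow> bool" where
  "uniformizing_chart Q W G \<longleftrightarrow>
     openin (chart_top Q) W \<and>
     finite G \<and> G \<subseteq> chart_pgroup Q \<and>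
     (\<forall>g\<in>G. Domain g = W \<and> Range g = W) \<and>
     Id_on W \<in> G \<and> (\<forall>g\<in>G. \<forall>h\<in>G. g O h \<in> G) \<and> (\<forall>g\<in>G. g\<inverse> \<in> G) \<and>
     (\<forall>r\<in>chart_pgroup Q. \<forall>a\<in>W. \<forall>b\<in>W. (a, b) \<in> r \<longrightarrow> (\<exists>g\<in>G. germ_eq (chart_top Q) a r g))"

definition orbispace_on :: "'x::topological_space set \<Rightarrow> ('c, 'x) orbispace \<Rightarrow> bool" where
  "orbispace_on X Q \<longleftrightarrow>
     Hausdorff_space (chart_top Q) \<and>
     pseudogroup (chart_top Q) (chart_pgroup Q) \<and>
     quotient_map (chart_top Q) (top_of_set X) (chart_proj Q) \<and>
     (\<forall>a\<in>topspace (chart_top Q). \<forall>b\<in>topspace (chart_top Q).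
        chart_proj Q a = chart_proj Q b \<longleftrightarrow> (\<exists>r\<in>chart_pgroup Q. (a, b) \<in> r)) \<and>
     (\<forall>a\<in>topspace (chart_top Q). \<exists>W G. a \<in> W \<and> uniformizing_chart Q W G)"

text \<open>The points with nontrivial isotropy group.\<close>

definition singular_locus :: "('c, 'x) orbispace \<Rightarrow> 'x set" where
  "singular_locus Q =
     {chart_proj Q a | a. a \<in> topspace (chart_top Q) \<and>
        (\<exists>r\<in>chart_pgroup Q. (a, a) \<in> r \<and>
           \<not> germ_eq (chart_top Q) a r (Id_on (topspace (chart_top Q))))}"

text \<open>\<open>L\<close> is a lift to the atlases of the map \<open>\<phi>\<close> of the underlying spaces, carrying germs of the
  first pseudogroup to germs of the second one.\<close>

definition orbi_morphism ::
    "('x \<Rightarrow> 'y) \<Rightarrow> ('c \<Rightarrow> 'e) \<Rightarrow> ('c, 'x) orbispace \<Rightarrow> ('e, 'y) orbispace \<Rightarrow> bool" where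
  "orbi_morphism \<phi> L Q R \<longleftrightarrow>
     continuous_map (chart_top Q) (chart_top R) L \<and>
     (\<forall>a\<in>topspace (chart_top Q). chart_proj R (L a) = \<phi> (chart_proj Q a)) \<and>
     (\<forall>r\<in>chart_pgroup Q. \<forall>(a, b)\<in>r. \<exists>s\<in>chart_pgroup R. \<exists>N. openin (chart_top Q) N \<and> a \<in> N \<and>
        (\<forall>(x, y)\<in>r. x \<in> N \<longrightarrow> (L x, L y) \<in> s))"

text \<open>Coverings of orbispaces in the sense of Thurston: every point has a neighbourhood uniformized
  by a chart \<open>(W, G)\<close> such that \<open>\<phi>\<close> is, on each connected component of the preimage of this
  neighbourhood, the natural map from the quotient of \<open>W\<close> by a subgroup of \<open>G\<close> to the quotient of
  \<open>W\<close> by \<open>G\<close>.  Here the chart \<open>W1\<close> over the component is identified with \<open>W\<close> by the lift \<open>L\<close>.\<close>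

definition orbi_covering ::
    "'x set \<Rightarrow> 'y set \<Rightarrow> ('x::topological_space \<Rightarrow> 'y) \<Rightarrow> ('c \<Rightarrow> 'e)
     \<Rightarrow> ('c, 'x) orbispace \<Rightarrow> ('e, 'y) orbispace \<Rightarrow> bool" where
  "orbi_covering X Y \<phi> L Q R \<longleftrightarrow>
     orbi_morphism \<phi> L Q R \<and>
     (\<forall>y\<in>Y. \<exists>W G. uniformizing_chart R W G \<and> y \<in> chart_proj R ` W \<and>
        (\<forall>C\<in>components (X \<inter> \<phi> -` (chart_proj R ` W)).
           \<exists>W1 G1. uniformizing_chart Q W1 G1 \<and> chart_proj Q ` W1 = C \<and>
             homeomorphic_map (subtopology (chart_top Q) W1) (subtopology (chart_top R) W) L \<and>
             (\<forall>g\<in>G1. map_prod L L ` g \<in> G)))"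

text \<open>A metric on the atlas for which the pseudogroup acts by local isometries.\<close>

definition orbispace_metric :: "('c, 'x) orbispace \<Rightarrow> ('c \<Rightarrow> 'c \<Rightarrow> real) \<Rightarrow> bool" where
  "orbispace_metric Q d \<longleftrightarrow>
     Metric_space (topspace (chart_top Q)) d \<and>
     Metric_space.mtopology (topspace (chart_top Q)) d = chart_top Q \<and>
     (\<forall>r\<in>chart_pgroup Q. \<forall>a\<in>Domain r. \<exists>N. openin (chart_top Q) N \<and> a \<in> N \<and>
        (\<forall>(x, y)\<in>r. \<forall>(x', y')\<in>r. x \<in> N \<and> x' \<in> N \<longrightarrow> d y y' = d x x'))"


section \<open>Sub-hyperbolicity\<close>

text \<open>As usual for partial self-coverings of orbispaces, \<open>f_map\<close> is a covering \<open>Q1 \<rightarrow> Q\<close>, where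
  \<open>Q1\<close> is an orbispace with the same underlying space as \<open>Q\<close> such that the identity map lifts to a
  morphism \<open>Q1 \<rightarrow> Q\<close>.  One cannot in general take \<open>Q1 = Q\<close>: the line \<open>z = w - u\<close> is mapped
  without ramification onto \<open>z = w\<close>, which is necessarily singular (\<open>w = 2z\<close> is mapped to \<open>z = 0\<close>
  with ramification, and then \<open>z = 0\<close> to \<open>z = u\<close> and \<open>z = u\<close> to \<open>z = w\<close>), hence it is singular in
  \<open>Q1\<close>, but it is not contained in the post-critical set, hence it is regular in \<open>Q\<close>.

  Expansion is measured in the charts: \<open>F\<close> and \<open>I\<close> are the lifts of \<open>f_map\<close> and of the identity,
  so that \<open>d (F b) (F c)\<close> is to be compared with \<open>d (I b) (I c)\<close>.

  The type \<open>nat \<times> complex \<times> complex\<close> merely supplies continuum many names for the points of the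
  charts, whose topology is \<open>chart_top\<close>; this suffices for any (sub-)atlas with countably many
  charts, since every chart is finite-to-one over the plane.\<close>

type_synonym chart_pt = "nat \<times> complex \<times> complex"

definition sub_hyperbolic :: bool where
  "sub_hyperbolic \<longleftrightarrow>
     (\<exists>(Q :: (chart_pt, 3 cproj) orbispace) (Q1 :: (chart_pt, 3 cproj) orbispace) F I d.
        orbispace_on (- {pt3 1 0 0}) Q \<and>
        orbispace_on (- {pt3 1 0 0}) Q1 \<and>
        singular_locus Q \<subseteq> postcritical \<and>
        orbi_covering (- {pt3 1 0 0}) (- {pt3 1 0 0}) f_map F Q1 Q \<and>
        orbi_morphism id I Q1 Q \<and>
        orbispace_metric Q d \<and>
        (\<exists>N l. open N \<and> julia \<subseteq> N \<and> l > 1 \<and>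
           (\<forall>a\<in>topspace (chart_top Q1). chart_proj Q1 a \<in> N \<longrightarrow>
              (\<exists>A. openin (chart_top Q1) A \<and> a \<in> A \<and>
                 (\<forall>b\<in>A. \<forall>c\<in>A. d (F b) (F c) \<ge> l * d (I b) (I c))))))"

end

theory Submission
  imports Defs
begin

text \<open>On homogeneous coordinates \<open>f\<close> maps the line through \<open>(w, u)\<close> to the line through
  \<open>((w - 2u)\<^sup>2, w\<^sup>2)\<close> by \<open>z \<mapsto> (w - 2z)\<^sup>2\<close>, with critical value \<open>0\<close>; hence each \<open>J\<close> is the full preimage
  of the next one, and all of them contain \<open>0\<close>, \<open>u\<close> and \<open>w\<close>.

  On the line \<open>w = u\<close> the Julia set is a segment, and the preimage of a finite tree that contains the
  critical value is a finite tree.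

  Conversely, let \<open>e n\<close> be the number of noncut points (ends) of the \<open>n\<close>-th iterated image of a
  tree. Both preimages of a noncut point other than \<open>0\<close> are noncut points, so
  \<open>e n \<ge> 2 (e (n + 1) - 1)\<close>; and \<open>e n \<ge> 2\<close> for every nondegenerate continuum. Thus eventually
  \<open>e n = 2\<close>; then \<open>0\<close> is an end, and both ends are mapped to the end other than \<open>0\<close> of the next tree.
  As \<open>0\<close> is mapped to \<open>u\<close> and \<open>u\<close> to \<open>w\<close>, this yields \<open>w = u\<close>.\<close>

section \<open>Noncut points\<close>

definition noncut :: "'a::topological_space set \<Rightarrow> 'a set" where
  "noncut S = {x \<in> S. connected (S - {x})}"

text \<open>If at most one point \<open>p\<close> were noncut, choose for each other \<open>x\<close> a piece \<open>U x\<close> of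
  \<open>S - {x}\<close> that misses \<open>p\<close>. The closed sets \<open>insert x (U x)\<close> shrink strictly when \<open>x\<close> moves into
  \<open>U x\<close>, which contradicts compactness along a maximal chain.\<close>

lemma two_noncut_points:
  fixes S :: "'a::heine_borel set"
  assumes "compact S" "connected S" "a \<in> S" "b \<in> S" "a \<noteq> b"
  obtains x y where "x \<in> noncut S" "y \<in> noncut S" "x \<noteq> y"
proof (rule ccontr)
  assume "\<not> thesis"
  with that have uniq: "x = y" if "x \<in> noncut S" "y \<in> noncut S" for x y
    using that by blast
  obtain p where p: "p \<in> S" "noncut S \<subseteq> {p}"
  proof (cases "noncut S = {}")
    case True
    then show ?thesis using that[of a] \<open>a \<in> S\<close> by auto
  next
    case False
    then obtain q where "q \<in> noncut S" by blast
    with uniq that[of q] show ?thesis by (auto simp: noncut_def)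
  qed
  \<comment> \<open>Removing the cut point \<open>x\<close> leaves a proper nonempty clopen part
    \<open>W\<close>; of \<open>W\<close> and its complement, the one without \<open>p\<close> is
    chosen.\<close>
  have "\<exists>U. U \<noteq> {} \<and> U \<subseteq> S - {x} \<and> p \<notin> U \<and>
      openin (top_of_set (S - {x})) U \<and> closedin (top_of_set (S - {x})) U"
    if x: "x \<in> S - {p}" for x
  proof -
    have "\<not> connected (S - {x})" using p x by (auto simp: noncut_def)
    then obtain W where W: "closedin (top_of_set (S - {x})) W" "openin (top_of_set (S - {x})) W"
      "W \<noteq> {}" "W \<noteq> S - {x}" by (auto simp: connected_clopen)
    have "W \<subseteq> S - {x}" using W(2) openin_imp_subset by blast
    moreover have "openin (top_of_set (S - {x})) (S - {x} - W)"
      using W(1) by (simp add: closedin_def)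
    moreover have "closedin (top_of_set (S - {x})) (S - {x} - W)"
      using openin_closedin_eq[THEN iffD1, OF W(2)] by simp
    ultimately show ?thesis
      using W by (intro exI[of _ "if p \<in> W then S - {x} - W else W"]) auto
  qed
  then obtain U where U: "\<And>x. x \<in> S - {p} \<Longrightarrow> U x \<noteq> {}" "\<And>x. x \<in> S - {p} \<Longrightarrow> U x \<subseteq> S - {x}"
    "\<And>x. x \<in> S - {p} \<Longrightarrow> p \<notin> U x"
    "\<And>x. x \<in> S - {p} \<Longrightarrow> openin (top_of_set (S - {x})) (U x)"
    "\<And>x. x \<in> S - {p} \<Longrightarrow> closedin (top_of_set (S - {x})) (U x)"
    by metis
  have closed: "closedin (top_of_set S) (insert x (U x))" if "x \<in> S - {p}" for x
  proof -
    have "openin (top_of_set (S - {x})) (S - {x} - U x)"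
      using U(5)[OF that] by (simp add: closedin_def)
    then have "openin (top_of_set S) (S - {x} - U x)"
      by (rule openin_trans) (simp add: openin_delete)
    moreover have "S - {x} - U x = S - insert x (U x)" by blast
    moreover have "insert x (U x) \<subseteq> S" using U(2)[OF that] that by blast
    ultimately show ?thesis
      by (simp add: closedin_def)
  qed
  \<comment> \<open>The part \<open>?V\<close> of \<open>S - {x}\<close> outside \<open>U x\<close>
    becomes connected when \<open>x\<close> is added, because \<open>S\<close> is connected. It
    contains \<open>p\<close> and avoids \<open>y\<close>, so it lies wholly in the part of
    \<open>S - {y}\<close> outside \<open>U y\<close>. Hence \<open>U y\<close> stays inside
    \<open>U x\<close>.\<close>
  have nest: "insert y (U y) \<subseteq> U x" if x: "x \<in> S - {p}" and y: "y \<in> U x" for x y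
  proof -
    have yS: "y \<in> S - {p}" using U(2,3)[OF x] y by blast
    let ?V = "S - {x} - U x"
    have V: "openin (top_of_set (S - {x})) ?V" "closedin (top_of_set (S - {x})) ?V"
      using U(4,5)[OF x] by (auto simp: closedin_def openin_imp_subset double_diff)
    have con: "connected ({x} \<union> ?V)"
      using connected_Un_clopen_in_complement[of "{x}" S ?V] V x \<open>connected S\<close> by auto
    have sub: "{x} \<union> ?V \<subseteq> S - {y}" using x y U(2)[OF x] by blast
    have "p \<in> {x} \<union> ?V" using p U(3)[OF x] by blast
    have "({x} \<union> ?V) \<inter> U y = {}"
    proof (rule ccontr)
      assume ne: "({x} \<union> ?V) \<inter> U y \<noteq> {}"
      obtain P where "open P" "U y = (S - {y}) \<inter> P"
        using U(4)[OF yS] by (auto simp: openin_open)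
      then have "openin (top_of_set ({x} \<union> ?V)) (({x} \<union> ?V) \<inter> U y)"
        using sub by (metis inf.absorb_iff1 inf_assoc openin_open_Int)
      moreover obtain Q where "closed Q" "U y = (S - {y}) \<inter> Q"
        using U(5)[OF yS] by (auto simp: closedin_closed)
      then have "closedin (top_of_set ({x} \<union> ?V)) (({x} \<union> ?V) \<inter> U y)"
        using sub by (metis inf.absorb_iff1 inf_assoc closedin_closed_Int)
      ultimately have "({x} \<union> ?V) \<inter> U y = {x} \<union> ?V"
        using con ne unfolding connected_clopen by blast
      then show False using \<open>p \<in> {x} \<union> ?V\<close> U(3)[OF yS] by blast
    qed
    then show ?thesis using U(2)[OF yS] y by blast
  qed
  define F where "F = (\<lambda>x. insert x (U x)) ` (S - {p})"
  obtain M where "subset.maxchain F M" using subset.Hausdorff by blast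
  then have chM: "subset.chain F M" and mx: "\<And>N. subset.chain F N \<Longrightarrow> \<not> M \<subset> N"
    unfolding subset.maxchain_def by auto
  have MF: "M \<subseteq> F" and ch: "\<And>X Y. X \<in> M \<Longrightarrow> Y \<in> M \<Longrightarrow> X \<subseteq> Y \<or> Y \<subseteq> X"
    using chM by (auto simp: subset_chain_def)
  \<comment> \<open>A member of \<open>F\<close> below the whole chain extends it, so maximality
    puts it into \<open>M\<close>.\<close>
  have ext: "X \<in> M" if "X \<in> F" "\<And>Y. Y \<in> M \<Longrightarrow> X \<subseteq> Y" for X
  proof -
    have "subset.chain F (insert X M)"
      using that MF ch by (auto simp: subset_chain_def)
    then show ?thesis using mx[of "insert X M"] by blast
  qed
  have "\<Inter>M \<noteq> {}"
  proof (rule compact_chain)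
    show "compact X" if "X \<in> M" for X
      using MF that closed closedin_compact[OF \<open>compact S\<close>] by (auto simp: F_def)
    show "{} \<notin> M" using MF by (auto simp: F_def)
  qed (use ch in blast)
  then obtain q where q: "\<And>X. X \<in> M \<Longrightarrow> q \<in> X" by blast
  obtain c where c: "c \<in> S - {p}" using assms p by blast
  have "M \<noteq> {}" using ext[of "insert c (U c)"] c by (auto simp: F_def)
  then obtain x0 where "x0 \<in> S - {p}" "q \<in> insert x0 (U x0)" using MF q by (fastforce simp: F_def)
  then have qS: "q \<in> S - {p}" using U(2,3)[of x0] by blast
  have sub: "insert q (U q) \<subseteq> X" if "X \<in> M" for X
    using MF q[OF that] that nest by (fastforce simp: F_def)
  obtain y where y: "y \<in> U q" using U(1)[OF qS] by blast
  have yS: "y \<in> S - {p}" using U(2,3)[OF qS] y by blast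
  \<comment> \<open>This set lies below every member of the chain, so it belongs to \<open>M\<close>
    and contains \<open>q\<close>. By \<open>nest\<close> it also lies in \<open>U q\<close>, which
    misses \<open>q\<close>.\<close>
  have "insert y (U y) \<in> M"
    using ext[of "insert y (U y)"] nest[OF qS y] sub yS by (fastforce simp: F_def)
  then have "q \<in> U q" using q nest[OF qS y] by blast
  then show False using U(2)[OF qS] by blast
qed

section \<open>Preimages under quadratic polynomials\<close>

abbreviation quad :: "complex \<Rightarrow> complex \<Rightarrow> complex" where
  "quad w z \<equiv> (w - 2 * z)\<^sup>2"

lemma quad_flip: "quad w (w - z) = quad w z"
  by (simp add: power2_eq_square algebra_simps)

lemma quad_flip': "(2 * z - w)\<^sup>2 = quad w z"
  by (rule power2_commute)

lemma quad_eq_iff: "quad w z = quad w z' \<longleftrightarrow> z' = z \<or> z' = w - z"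
proof -
  have "w - 2 * z = - (w - 2 * z') \<longleftrightarrow> 2 * (w - z) = 2 * z'"
    by (auto simp: eq_neg_iff_add_eq_0 algebra_simps)
  then have "w - 2 * z = - (w - 2 * z') \<longleftrightarrow> z' = w - z"
    unfolding mult_cancel_left by auto
  moreover have "w - 2 * z = w - 2 * z' \<longleftrightarrow> z' = z" by auto
  ultimately show ?thesis by (simp add: power2_eq_iff)
qed

lemma quad_surj: "\<exists>z. quad w z = y"
  by (rule exI[of _ "(w - csqrt y) / 2"]) (simp add: field_simps)

text \<open>The difference of the values is \<open>- 4 * ((z - a) * ((w - z) - a))\<close>, so both
  factors cannot have norm at least \<open>e\<close>. This is openness of \<open>quad w\<close>,
  with a uniform constant and up to the reflection \<open>z \<mapsto> w - z\<close>.\<close>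

lemma quad_close:
  assumes "norm (quad w z - quad w a) < 4 * e\<^sup>2" "e > 0"
  shows "norm (z - a) < e \<or> norm ((w - z) - a) < e"
proof (rule ccontr)
  assume "\<not> ?thesis"
  then have "e * e \<le> norm (z - a) * norm ((w - z) - a)"
    using assms(2) by (intro mult_mono) auto
  also have "\<dots> = norm (quad w z - quad w a) / 4"
  proof -
    have "quad w z - quad w a = - 4 * ((z - a) * ((w - z) - a))"
      by (simp add: power2_eq_square algebra_simps)
    then show ?thesis by (simp add: norm_mult)
  qed
  finally show False using assms(1) by (simp add: power2_eq_square)
qed

text \<open>The preimage contains the critical point \<open>w / 2\<close>, which lies over
  \<open>0\<close> and is fixed by the reflection. A clopen part around it can be made symmetric,
  and symmetric clopen parts have disjoint open images; connectedness of \<open>X\<close> leaves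
  room for only one of them.\<close>

lemma connected_vimage_quad:
  assumes X: "connected X" "0 \<in> X"
  shows "connected (quad w -` X)"
proof -
  let ?P = "quad w -` X"
  have *: "openin (top_of_set X) (quad w ` V)"
    \<comment> \<open>A point of \<open>X\<close> near \<open>quad w a\<close> has a preimage near
      \<open>a\<close> after a possible reflection, and a symmetric \<open>V\<close> does not notice
      the reflection.\<close>
    if V: "openin (top_of_set ?P) V" "\<And>z. z \<in> V \<Longrightarrow> w - z \<in> V" for V
    unfolding openin_euclidean_subtopology_iff
  proof (intro conjI ballI)
    show "quad w ` V \<subseteq> X" using openin_imp_subset[OF V(1)] by auto
    fix y assume "y \<in> quad w ` V"
    then obtain a where a: "a \<in> V" "y = quad w a" by blast
    then obtain e where e: "e > 0" "\<And>z. z \<in> ?P \<Longrightarrow> dist z a < e \<Longrightarrow> z \<in> V"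
      using V(1) unfolding openin_euclidean_subtopology_iff by blast
    have "x \<in> quad w ` V" if x: "x \<in> X" "dist x y < 4 * e\<^sup>2" for x
    proof -
      obtain z where z: "quad w z = x" using quad_surj by blast
      then have "norm (z - a) < e \<or> norm ((w - z) - a) < e"
        using x a e(1) by (intro quad_close) (auto simp: dist_norm)
      then have "z \<in> V \<or> w - z \<in> V"
        using e(2)[of z] e(2)[of "w - z"] z x quad_flip[of w z] by (auto simp: dist_norm)
      then show ?thesis using z quad_flip[of w z] imageI[of _ V "quad w"] by metis
    qed
    then show "\<exists>e>0. \<forall>x'\<in>X. dist x' y < e \<longrightarrow> x' \<in> quad w ` V"
      using e(1) by (intro exI[of _ "4 * e\<^sup>2"]) auto
  qed
  have main: "?P \<subseteq> V" if V: "openin (top_of_set ?P) V" "closedin (top_of_set ?P) V" "w / 2 \<in> V" for V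
  proof -
    let ?f = "\<lambda>z. w - z"
    have hom: "homeomorphism ?P ?P ?f ?f"
      by (rule homeomorphismI) (auto intro!: continuous_intros simp: quad_flip')
    \<comment> \<open>Intersecting with the mirror image makes the part symmetric without losing the
      fixed point \<open>w / 2\<close>. Then \<open>S\<close> and its complement are both unions of
      whole fibres of \<open>quad w\<close>, and their images are disjoint.\<close>
    define S where "S = V \<inter> ?f ` V"
    have o: "openin (top_of_set ?P) S" and c: "closedin (top_of_set ?P) S"
      unfolding S_def using V homeomorphism_imp_open_map[OF hom V(1)] homeomorphism_imp_closed_map[OF hom V(2)]
      by auto
    have sym: "w - z \<in> S" if "z \<in> S" for z using that by (auto simp: S_def)
    have o': "openin (top_of_set ?P) (?P - S)" using c by (simp add: closedin_def)
    have sym': "w - z \<in> ?P - S" if "z \<in> ?P - S" for z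
      using that sym[of "w - z"] by (auto simp: quad_flip')
    have "w / 2 \<in> S" using V(3) by (auto simp: S_def intro!: image_eqI[of _ _ "w/2"])
    then have "quad w ` S \<noteq> {}" by blast
    moreover have "quad w ` S \<inter> quad w ` (?P - S) = {}"
      using sym quad_eq_iff by (fastforce)
    moreover have "X \<subseteq> quad w ` S \<union> quad w ` (?P - S)"
    proof
      fix x assume "x \<in> X"
      moreover obtain z where "quad w z = x" using quad_surj by blast
      ultimately show "x \<in> quad w ` S \<union> quad w ` (?P - S)" by (cases "z \<in> S") auto
    qed
    ultimately have "quad w ` (?P - S) = {}"
      using X(1) *[OF o sym] *[OF o' sym'] unfolding connected_openin by blast
    then show ?thesis by (auto simp: S_def)
  qed
  show ?thesis
    unfolding connected_clopen
  proof (intro allI impI)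
    fix V assume V: "openin (top_of_set ?P) V \<and> closedin (top_of_set ?P) V"
    then have VP: "V \<subseteq> ?P" using openin_imp_subset by blast
    show "V = {} \<or> V = ?P"
    proof (cases "w / 2 \<in> V")
      case True
      then have "?P \<subseteq> V" using V by (intro main) auto
      then show ?thesis using VP by blast
    next
      case False
      then have "?P \<subseteq> ?P - V"
        using V X(2) openin_closedin_eq[THEN iffD1, of "top_of_set ?P" V]
        by (intro main) (auto simp: closedin_def)
      then show ?thesis using VP by blast
    qed
  qed
qed

text \<open>Deleting both \<open>x\<close> and its mirror image \<open>w - x\<close> leaves the
  preimage of a connected set that still contains \<open>0\<close>, hence a connected set. Putting
  back \<open>w - x\<close>, a limit point of it, keeps it connected.\<close>

lemma noncut_vimage_quad:
  assumes T: "connected T" "0 \<in> T" and x: "quad w x \<in> noncut T" "quad w x \<noteq> 0"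
  shows "x \<in> noncut (quad w -` T)"
proof -
  let ?y = "quad w x"
  have y: "?y \<in> T" "connected (T - {?y})" using x by (auto simp: noncut_def)
  let ?P = "quad w -` (T - {?y})"
  have "connected (quad w -` T - {x})"
  proof (rule connected_intermediate_closure[of ?P])
    show "connected ?P" using y T x by (intro connected_vimage_quad) auto
    show "?P \<subseteq> quad w -` T - {x}" by auto
    have "w - x \<in> closure ?P"
      unfolding closure_approachable
    proof (intro allI impI)
      fix e :: real assume e: "e > 0"
      \<comment> \<open>\<open>T\<close> is connected and contains \<open>0\<close> besides
        \<open>?y\<close>, so it has no isolated points.\<close>
      have "?y islimpt T" using T y x by (intro connected_imp_perfect) auto
      moreover have "4 * e\<^sup>2 > 0" using e by simp
      ultimately obtain s where s: "s \<in> T" "s \<noteq> ?y" "dist s ?y < 4 * e\<^sup>2"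
        unfolding islimpt_approachable by blast
      obtain z where z: "quad w z = s" using quad_surj by blast
      have "norm (z - (w - x)) < e \<or> norm ((w - z) - (w - x)) < e"
        using s z e quad_flip[of w x] by (intro quad_close) (auto simp: dist_norm)
      moreover have "z \<in> ?P" "w - z \<in> ?P" using s z quad_flip[of w z] by auto
      ultimately show "\<exists>u\<in>?P. dist u (w - x) < e" unfolding dist_norm by blast
    qed
    moreover have "quad w -` T - {x} \<subseteq> insert (w - x) ?P" by (auto simp: quad_eq_iff)
    ultimately show "quad w -` T - {x} \<subseteq> closure ?P" using closure_subset by blast
  qed
  then show ?thesis using y by (simp add: noncut_def)
qed

lemma card_vimage_quad:
  assumes "finite D" "0 \<notin> D"
  shows "finite (quad w -` D)" "card (quad w -` D) = 2 * card D"
proof -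
  let ?f = "\<lambda>d. (w - csqrt d) / 2" and ?g = "\<lambda>d. (w + csqrt d) / 2"
  have eq: "quad w -` D = ?f ` D \<union> ?g ` D"
  proof (intro equalityI subsetI)
    fix z assume "z \<in> quad w -` D"
    then have z: "quad w z \<in> D" by simp
    have "quad w z = quad w (?f (quad w z))" by (simp add: field_simps)
    then have "z = ?f (quad w z) \<or> z = ?g (quad w z)"
      unfolding quad_eq_iff by (auto simp: field_simps)
    with z show "z \<in> ?f ` D \<union> ?g ` D" by blast
  qed (auto simp: field_simps)
  have inj: "inj_on ?f D" "inj_on ?g D"
    by (auto intro!: inj_onI) (metis power2_csqrt)+
  have dis: "?f ` D \<inter> ?g ` D = {}"
  proof -
    \<comment> \<open>A common value of the two root branches would be a vanishing root, and
      \<open>0\<close> is not in \<open>D\<close>.\<close>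
    have False if "c \<in> D" "d \<in> D" "- csqrt c = csqrt d" for c d
    proof -
      have "c = d" using that(3) by (metis power2_csqrt power2_minus)
      with that(3) have "csqrt d = 0" by simp
      with that assms(2) show False by simp
    qed
    then show ?thesis by (auto simp: diff_conv_add_uminus simp del: add_uminus_conv_diff)
  qed
  show "finite (quad w -` D)" "card (quad w -` D) = 2 * card D"
    unfolding eq using assms(1) dis inj by (auto simp: card_Un_disjoint card_image)
qed

section \<open>Simplicial trees\<close>

lemma face_of_closed_segment_cases:
  fixes a b :: "'a::euclidean_space"
  assumes "F face_of closed_segment a b"
  shows "F = {} \<or> F = {a} \<or> F = {b} \<or> F = closed_segment a b"
proof -
  obtain C where "C \<subseteq> {a, b}" "F = convex hull C"
    using face_of_convex_hull_subset[of "{a, b}" F] assms by (auto simp: segment_convex_hull)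
  moreover from this have "C = {} \<or> C = {a} \<or> C = {b} \<or> C = {a, b}" by blast
  ultimately show ?thesis by (elim disjE) (simp_all add: segment_convex_hull)
qed

locale graph_complex =
  fixes K :: "'a::euclidean_space set set"
  assumes complex: "simplicial_complex K" and dim: "\<And>S. S \<in> K \<Longrightarrow> aff_dim S \<le> 1"
begin

lemma finite_K: "finite K"
  using complex by (simp add: simplicial_complex_def)

lemma face_in_K: "S \<in> K \<Longrightarrow> F face_of S \<Longrightarrow> F \<in> K"
  using complex unfolding simplicial_complex_def by blast

lemma is_simplex: "S \<in> K \<Longrightarrow> \<exists>n. n simplex S"
  using complex unfolding simplicial_complex_def by blast

lemma Int_face: "S \<in> K \<Longrightarrow> S' \<in> K \<Longrightarrow> (S \<inter> S') face_of S"
  using complex by (simp add: simplicial_complex_def)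

text \<open>A simplex of dimension at most one is the hull of one or two points; allowing
  \<open>a = b\<close> treats vertices as degenerate edges.\<close>

lemma simplex_cases:
  assumes "S \<in> K" "S \<noteq> {}"
  obtains a b where "S = closed_segment a b" "a \<in> cx_vertices K" "b \<in> cx_vertices K"
proof -
  obtain n where n: "n simplex S" using is_simplex[OF assms(1)] by blast
  then have "n \<le> 1" using dim[OF assms(1)] aff_dim_simplex by metis
  moreover obtain C where C: "finite C" "int (card C) = n + 1" "S = convex hull C"
    using n unfolding simplex by blast
  ultimately have "card C \<le> 2" "C \<noteq> {}" using assms(2) by auto
  then have "card C = 1 \<or> card C = 2" using C(1) by (cases "card C") (auto simp: le_Suc_eq)
  then obtain a b where "C = {a, b}"
    by (auto simp: card_1_singleton_iff card_2_iff)
  then have S: "S = closed_segment a b" using C by (simp add: segment_convex_hull)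
  have "{a} face_of S" "{b} face_of S"
    unfolding S face_of_singleton extreme_point_of_segment by auto
  then show thesis using that S face_in_K[OF assms(1)] by (auto simp: cx_vertices_def)
qed

lemma vertex_in_segment:
  assumes "closed_segment a b \<in> K" "v \<in> cx_vertices K" "v \<in> closed_segment a b"
  shows "v = a \<or> v = b"
proof -
  have "(closed_segment a b \<inter> {v}) face_of closed_segment a b"
    using Int_face[OF assms(1), of "{v}"] assms(2) unfolding cx_vertices_def by blast
  then have "{v} face_of closed_segment a b" using assms(3) by simp
  then show ?thesis unfolding face_of_singleton extreme_point_of_segment .
qed

lemma compact_simplex_K: "S \<in> K \<Longrightarrow> compact S"
  using is_simplex compact_simplex by blast

lemma compact_Union_K: "compact (\<Union>K)"
  using finite_K compact_simplex_K by (rule compact_Union)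

lemma finite_vertices: "finite (cx_vertices K)"
proof -
  have "(\<lambda>v. {v}) ` cx_vertices K \<subseteq> K" by (auto simp: cx_vertices_def)
  then have "finite ((\<lambda>v. {v}) ` cx_vertices K)" using finite_K finite_subset by blast
  then show ?thesis by (rule finite_imageD) (auto simp: inj_on_def)
qed

lemma connected_Union_K:
  assumes conn: "\<And>v w. v \<in> cx_vertices K \<Longrightarrow> w \<in> cx_vertices K \<Longrightarrow> (v, w) \<in> (cx_adj K)\<^sup>*"
  shows "connected (\<Union>K)"
proof -
  let ?c = "connected_component (\<Union>K)"
  have seg: "?c x y" if "S \<in> K" "x \<in> S" "y \<in> S" for x y S
  proof -
    have "convex S" using is_simplex[OF that(1)] convex_simplex by blast
    then show ?thesis unfolding connected_component_def using that convex_connected by blast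
  qed
  have "?c v w" if "(v, w) \<in> (cx_adj K)\<^sup>*" "v \<in> cx_vertices K" for v w
    using that
  proof (induction)
    case base
    then show ?case using seg[of "{v}"] by (auto simp: cx_vertices_def)
  next
    case (step y z)
    have "?c y z" using step.hyps(2) by (auto simp: cx_adj_def intro: seg)
    then show ?case using step by (metis connected_component_trans)
  qed
  then have vert: "?c v w" if "v \<in> cx_vertices K" "w \<in> cx_vertices K" for v w
    using that conn by blast
  have "\<exists>v\<in>cx_vertices K. ?c x v" if x: "x \<in> \<Union>K" for x
  proof -
    obtain S where S: "S \<in> K" "x \<in> S" using x by blast
    then obtain a b where "S = closed_segment a b" "a \<in> cx_vertices K"
      using simplex_cases[of S] by blast
    then show ?thesis using seg[OF S, of a] by auto
  qed
  then show ?thesis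
    unfolding connected_iff_connected_component
    using vert by (meson connected_component_trans connected_component_sym)
qed

end

text \<open>A shortest detour from \<open>v\<close> to \<open>w\<close> has distinct vertices, and
  the edge \<open>(w, v)\<close> closes it to a cycle. The direct edge being removed, the detour has
  at least two steps, so the cycle has at least three vertices.\<close>

lemma edge_not_bypassed:
  assumes acyclic: "\<not> (\<exists>vs. length vs \<ge> 3 \<and> distinct vs \<and>
      (\<forall>i<length vs. (vs ! i, vs ! (Suc i mod length vs)) \<in> E))"
    and "(w, v) \<in> E" "v \<noteq> w"
  shows "(v, w) \<notin> (E - {(v, w), (w, v)})\<^sup>*"
proof
  let ?R = "E - {(v, w), (w, v)}"
  assume "(v, w) \<in> ?R\<^sup>*"
  then have ex: "\<exists>n. (v, w) \<in> ?R ^^ n" by (rule rtrancl_imp_relpow)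
  define n where "n = (LEAST n. (v, w) \<in> ?R ^^ n)"
  have n: "(v, w) \<in> ?R ^^ n" unfolding n_def using ex by (rule LeastI_ex)
  then obtain f where f: "f 0 = v" "f n = w" "\<And>i. i < n \<Longrightarrow> (f i, f (Suc i)) \<in> ?R"
    unfolding relpow_fun_conv by blast
  have "n \<noteq> 0" using f assms(3) by metis
  moreover have "n \<noteq> 1" using f(1,2) f(3)[of 0] by auto
  ultimately have n2: "n \<ge> 2" by simp
  \<comment> \<open>If a vertex recurred, cutting out the loop between its two visits would give a
    path shorter than the least length \<open>n\<close>.\<close>
  have "f i \<noteq> f j" if "i < j" "j \<le> n" for i j
  proof
    assume eq: "f i = f j"
    have "(v, f i) \<in> ?R ^^ i"
      unfolding relpow_fun_conv using f that by (intro exI[of _ f]) auto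
    moreover have "(f j, w) \<in> ?R ^^ (n - j)"
      unfolding relpow_fun_conv using f that by (intro exI[of _ "\<lambda>k. f (j + k)"]) auto
    ultimately have "(v, w) \<in> ?R ^^ (i + (n - j))" unfolding relpow_add eq by blast
    then have "n \<le> i + (n - j)" unfolding n_def by (rule Least_le)
    then show False using that by simp
  qed
  then have inj: "inj_on f {..n}" by (metis (no_types, lifting) atMost_iff inj_onI linorder_neqE_nat)
  let ?vs = "map f [0..<Suc n]"
  have "distinct ?vs" unfolding distinct_map using inj by (auto simp: inj_on_def)
  moreover have "(?vs ! i, ?vs ! (Suc i mod length ?vs)) \<in> E" if "i < length ?vs" for i
  proof (cases "i = n")
    case True
    then show ?thesis using f assms(2) by (simp del: upt_Suc)
  next
    case False
    then show ?thesis using f(3)[of i] that by (simp del: upt_Suc)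
  qed
  ultimately show False using acyclic n2 by (metis One_nat_def length_map length_upt diff_zero Suc_le_mono numeral_2_eq_2 numeral_3_eq_3)
qed

text \<open>An interior point of an edge separates the two sides of that edge.\<close>

lemma noncut_simplicial_tree:
  fixes K :: "'a::euclidean_space set set"
  assumes tree: "simplicial_tree K"
  shows "noncut (\<Union>K) \<subseteq> cx_vertices K"
proof (intro subsetI, rule ccontr)
  fix x assume x: "x \<in> noncut (\<Union>K)" "x \<notin> cx_vertices K"
  interpret graph_complex K using tree by unfold_locales (auto simp: simplicial_tree_def)
  obtain S0 where "S0 \<in> K" "x \<in> S0" using x by (auto simp: noncut_def)
  then obtain v w where vw: "closed_segment v w \<in> K" "x \<in> closed_segment v w"
    "v \<in> cx_vertices K" "w \<in> cx_vertices K"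
    using simplex_cases[of S0] by (metis emptyE)
  then have ne: "x \<noteq> v" "x \<noteq> w" "v \<noteq> w" using x by auto
  let ?e = "closed_segment v w"
  let ?R = "cx_adj K - {(v, w), (w, v)}"
  \<comment> \<open>The vertices on the side of \<open>v\<close> once the edge is removed;
    acyclicity keeps \<open>w\<close> out.\<close>
  define A where "A = ?R\<^sup>* `` {v}"
  have "v \<in> A" by (simp add: A_def)
  have "w \<notin> A"
    using edge_not_bypassed[of "cx_adj K" w v] tree vw ne
    by (auto simp: A_def simplicial_tree_def cx_adj_def closed_segment_commute)
  have A_vert: "A \<subseteq> cx_vertices K"
  proof
    fix a assume "a \<in> A"
    then have "(v, a) \<in> ?R\<^sup>*" by (simp add: A_def)
    then show "a \<in> cx_vertices K"
    proof (induction)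
      case (step y z)
      then have "closed_segment y z \<in> K" by (simp add: cx_adj_def)
      moreover have "{z} face_of closed_segment y z"
        unfolding face_of_singleton extreme_point_of_segment by simp
      ultimately show ?case using face_in_K by (simp add: cx_vertices_def)
    qed (use vw in simp)
  qed
  have in_A: "b \<in> A" if S: "S \<in> K" "S \<noteq> ?e" "a \<in> S" "a \<in> A" "b \<in> S" "b \<in> cx_vertices K" for S a b
  proof (cases "a = b")
    case False
    obtain s t where st: "S = closed_segment s t" using simplex_cases[of S] S by blast
    have "a = s \<or> a = t" "b = s \<or> b = t"
      using vertex_in_segment S st A_vert by blast+
    then have "S = closed_segment a b" using False st by (auto simp: closed_segment_commute)
    moreover from this have "{a, b} \<noteq> {v, w}" using S(2) by auto
    ultimately have "(a, b) \<in> ?R" using S(1) False by (auto simp: cx_adj_def)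
    then show ?thesis using S(4) unfolding A_def by (auto intro: rtrancl.rtrancl_into_rtrancl)
  qed (use S in simp)
  \<comment> \<open>The intersection is a face of \<open>?e\<close>. Were it all of
    \<open>?e\<close>, then \<open>?e\<close> would be a face of \<open>S\<close>; having two
    distinct endpoints, it would have to equal \<open>S\<close>.\<close>
  have e_Int: "y = v \<or> y = w" if S: "S \<in> K" "S \<noteq> ?e" "y \<in> S" "y \<in> ?e" for S y
  proof -
    have "(?e \<inter> S) face_of ?e" using Int_face vw(1) that(1) by blast
    moreover have "?e \<inter> S \<noteq> ?e"
    proof
      assume "?e \<inter> S = ?e"
      then have *: "?e face_of S" using Int_face[OF that(1) vw(1)] by (simp add: Int_commute)
      obtain s t where "S = closed_segment s t" using simplex_cases[of S] S by blast
      then show False using face_of_closed_segment_cases[of ?e s t] * that(2) ne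
        by (auto simp: closed_segment_eq_sing)
    qed
    ultimately show ?thesis using face_of_closed_segment_cases[of "?e \<inter> S" v w] that by blast
  qed
  have seg: "closed_segment v x \<inter> closed_segment x w = {x}"
    using vw(2) by (intro Int_closed_segment) auto
  have sub: "closed_segment v x \<subseteq> ?e" "closed_segment x w \<subseteq> ?e"
    using vw(2) by (auto simp: subset_closed_segment)
  have un: "closed_segment v x \<union> closed_segment x w = ?e"
    using vw(2) by (rule Un_closed_segment)
  \<comment> \<open>The simplices other than \<open>?e\<close> are sorted by whether they touch
    \<open>A\<close>, and \<open>?e\<close> itself is cut at \<open>x\<close>. This gives two closed
    sets \<open>P\<close> and \<open>Q\<close> that meet at most in \<open>x\<close>.\<close>
  define KA where "KA = {S \<in> K. S \<noteq> ?e \<and> S \<inter> A \<noteq> {}}"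
  define KB where "KB = {S \<in> K. S \<noteq> ?e \<and> S \<inter> A = {}}"
  define P where "P = \<Union>KA \<union> closed_segment v x"
  define Q where "Q = \<Union>KB \<union> closed_segment x w"
  have "closed (\<Union>KA)" "closed (\<Union>KB)"
    unfolding KA_def KB_def using finite_K compact_simplex_K
    by (auto intro!: closed_Union compact_imp_closed)
  then have cl: "closed P" "closed Q" by (auto simp: P_def Q_def)
  have cover: "\<Union>K - {x} \<subseteq> P \<union> Q"
    unfolding P_def Q_def KA_def KB_def using un by blast
  have "y = x" if "y \<in> P" "y \<in> Q" for y
  proof -
    consider S S' where "S \<in> KA" "S' \<in> KB" "y \<in> S" "y \<in> S'"
      | S where "S \<in> KA" "y \<in> S" "y \<in> closed_segment x w"
      | S where "S \<in> KB" "y \<in> S" "y \<in> closed_segment v x"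
      | "y \<in> closed_segment v x" "y \<in> closed_segment x w"
      using \<open>y \<in> P\<close> \<open>y \<in> Q\<close> unfolding P_def Q_def by blast
    then show ?thesis
    proof cases
      case 1
      then have SK: "S \<in> K" "S \<noteq> ?e" "S' \<in> K" by (auto simp: KA_def KB_def)
      obtain s t where st: "S = closed_segment s t" "s \<in> cx_vertices K" "t \<in> cx_vertices K"
        using simplex_cases[OF SK(1)] 1(3) by blast
      \<comment> \<open>Two simplices that meet share a vertex. By \<open>in_A\<close> all vertices
        of \<open>S\<close> lie in \<open>A\<close>, whereas \<open>S'\<close> contains no point of
        \<open>A\<close>.\<close>
      have "S \<inter> S' = {} \<or> S \<inter> S' = {s} \<or> S \<inter> S' = {t} \<or> S \<inter> S' = S"
        using face_of_closed_segment_cases Int_face[OF SK(1,3)] st(1) by metis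
      then have "s \<in> S' \<or> t \<in> S'" using 1 st(1) by auto
      moreover have "s \<in> A" "t \<in> A" using in_A[OF SK(1,2)] 1(1) st by (auto simp: KA_def)
      ultimately show ?thesis using 1(2) by (auto simp: KB_def)
    next
      case 2
      then have "y = v \<or> y = w" using e_Int[of S y] sub by (auto simp: KA_def)
      moreover have "y \<noteq> w"
        using in_A[of S _ w] \<open>w \<notin> A\<close> 2 vw(4) by (auto simp: KA_def)
      ultimately show ?thesis using seg 2 by auto
    next
      case 3
      then have "y = v \<or> y = w" using e_Int[of S y] sub by (auto simp: KB_def)
      moreover have "y \<noteq> v" using \<open>v \<in> A\<close> 3 by (auto simp: KB_def)
      ultimately show ?thesis using seg 3 by auto
    qed (use seg in blast)
  qed
  then have "P \<inter> Q \<inter> (\<Union>K - {x}) = {}" by blast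
  moreover have "v \<in> P \<inter> (\<Union>K - {x})" "w \<in> Q \<inter> (\<Union>K - {x})"
    using vw ne by (auto simp: P_def Q_def)
  ultimately have "\<not> connected (\<Union>K - {x})"
    unfolding connected_closed using cl cover by blast
  then show False using x by (simp add: noncut_def)
qed

section \<open>Trees built from arcs\<close>

lemma arc_continuous_image:
  assumes "arc g" "continuous_on (path_image g) f" "inj_on f (path_image g)"
  shows "arc (f \<circ> g)"
  using assms by (auto simp: arc_def path_image_def intro: path_continuous_image comp_inj_on)

text \<open>A tree \<open>S\<close> with root \<open>r\<close> and marked vertices \<open>V\<close>,
  grown by gluing arcs one at a time at existing vertices. The arcs may be curved, so this form
  passes to preimages under quadratic maps, which straight simplicial complexes do not.\<close>

inductive rtree :: "'a::real_normed_vector \<Rightarrow> 'a set \<Rightarrow> 'a set \<Rightarrow> bool" for r where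
  root: "rtree r {r} {r}"
| attach: "rtree r V S \<Longrightarrow> arc g \<Longrightarrow> pathstart g \<in> V \<Longrightarrow> path_image g \<inter> S = {pathstart g} \<Longrightarrow>
    rtree r (insert (pathfinish g) V) (S \<union> path_image g)"

lemma rtree_props:
  assumes "rtree r V S"
  shows "r \<in> V" "V \<subseteq> S" "compact S"
  using assms by (induction) (auto intro!: compact_Un simp: compact_arc_image compact_path_image arc_imp_path)

lemma rtree_arc:
  assumes "arc g"
  shows "rtree (pathstart g) {pathfinish g, pathstart g} (path_image g)"
proof -
  have "path_image g \<inter> {pathstart g} = {pathstart g}" by auto
  then show ?thesis
    using attach[OF root assms, of "pathstart g"] by (simp add: insert_absorb pathstart_in_path_image)
qed

text \<open>The arcs of the second tree are glued to the first in their original order; each still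
  meets what is already there only in its starting point.\<close>

lemma rtree_join:
  assumes "rtree p W T" "rtree r V S" "p \<in> V" "S \<inter> T = {p}"
  shows "rtree r (V \<union> W) (S \<union> T)"
  using assms
proof (induction)
  case root
  then show ?case using rtree_props by (metis Un_insert_right insert_absorb subsetD sup_bot.right_neutral)
next
  case (attach W T g)
  have "p \<in> T" using rtree_props[OF attach.hyps(1)] by blast
  then have ST: "S \<inter> T = {p}" using attach.prems by blast
  have "path_image g \<inter> (S \<union> T) = {pathstart g}"
    using attach.prems attach.hyps \<open>p \<in> T\<close> by blast
  then have "rtree r (insert (pathfinish g) (V \<union> W)) ((S \<union> T) \<union> path_image g)"
    using attach.IH[OF attach.prems(1,2) ST] attach.hyps by (intro rtree.attach) auto
  then show ?case by (simp add: Un_assoc)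
qed

text \<open>If the new root is the free end of the last arc, that arc is reversed and the older
  tree, rerooted at the gluing point, is joined to it.\<close>

lemma rtree_reroot:
  assumes "rtree r V S" "v \<in> V"
  shows "rtree v V S"
  using assms
proof (induction arbitrary: v)
  case root
  then show ?case by (simp add: rtree.root)
next
  case (attach V S g)
  show ?case
  proof (cases "v \<in> V")
    case True
    then show ?thesis using attach by (intro rtree.attach) auto
  next
    case False
    then have v: "v = pathfinish g" using attach by auto
    have "rtree v {pathstart g, v} (path_image g)"
      using rtree_arc[of "reversepath g"] attach.hyps v by (simp add: arc_reversepath)
    then have "rtree v ({pathstart g, v} \<union> V) (path_image g \<union> S)"
      using attach.IH[OF attach.hyps(3)] attach.hyps(4) by (intro rtree_join) auto
    moreover have "{pathstart g, v} \<union> V = insert (pathfinish g) V" using attach.hyps v by auto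
    ultimately show ?thesis by (simp add: Un_commute)
  qed
qed

text \<open>An arc with \<open>x\<close> in its interior is split there into two arcs, which are
  glued one after the other.\<close>

lemma rtree_subdivide:
  assumes "rtree r V S" "x \<in> S"
  shows "\<exists>V'. rtree r V' S \<and> insert x V \<subseteq> V'"
  using assms
proof (induction)
  case root
  then show ?case using rtree.root by blast
next
  case (attach V S g)
  consider "x \<in> S" | "x = pathfinish g" | "x \<notin> S" "x \<noteq> pathfinish g" by blast
  then show ?case
  proof cases
    case 1
    then obtain V' where V': "rtree r V' S" "insert x V \<subseteq> V'" using attach.IH by blast
    then have "rtree r (insert (pathfinish g) V') (S \<union> path_image g)"
      using attach.hyps by (intro rtree.attach) auto
    then show ?thesis using V' by blast
  next
    case 2
    then show ?thesis using rtree.attach[OF attach.hyps] by blast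
  next
    case 3
    then obtain t where t: "t \<in> {0..1}" "x = g t" using attach.prems by (auto simp: path_image_def)
    have t01: "t \<noteq> 0" "t \<noteq> 1"
      using 3 t attach.hyps rtree_props(2)[OF attach.hyps(1)] by (auto simp: pathstart_def pathfinish_def)
    have inj: "inj_on g {0..1}" using attach.hyps by (simp add: arc_def)
    let ?g1 = "subpath 0 t g" and ?g2 = "subpath t 1 g"
    have im: "path_image ?g1 = g ` {0..t}" "path_image ?g2 = g ` {t..1}"
      using t by (auto simp: path_image_subpath)
    have arcs: "arc ?g1" "arc ?g2"
      using attach.hyps t t01 by (auto intro!: arc_subpath_arc)
    have Sg: "g s \<in> S \<longleftrightarrow> s = 0" if "s \<in> {0..1}" for s
    proof -
      have "g s \<in> S \<longleftrightarrow> g s = g 0" using attach.hyps(4) that by (auto simp: path_image_def pathstart_def)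
      then show ?thesis using inj that by (auto simp: inj_on_def)
    qed
    have "path_image ?g1 \<inter> S = {pathstart ?g1}"
      using im Sg t by (auto simp: pathstart_def[of g])
    then have 1: "rtree r (insert x V) (S \<union> path_image ?g1)"
      using rtree.attach[OF attach.hyps(1) arcs(1)] attach.hyps(3) t by (simp add: pathstart_def[of g])
    have "path_image ?g2 \<inter> (S \<union> path_image ?g1) = {pathstart ?g2}"
    proof -
      have "g ` {t..1} \<inter> g ` {0..t} = g ` ({t..1} \<inter> {0..t})"
        using inj_on_image_Int[OF inj, of "{t..1}" "{0..t}"] t by auto
      moreover have "{t..1} \<inter> {0..t} = {t}" using t by auto
      moreover have "g ` {t..1} \<inter> S = {}" using Sg t t01 by auto
      ultimately show ?thesis unfolding im Int_Un_distrib by simp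
    qed
    then have "rtree r (insert (pathfinish g) (insert x V)) (S \<union> path_image ?g1 \<union> path_image ?g2)"
      using rtree.attach[OF 1 arcs(2)] t by (simp add: pathfinish_def[of g])
    moreover have "path_image ?g1 \<union> path_image ?g2 = path_image g"
    proof -
      have "{0..t} \<union> {t..1} = {0..1}" using t by auto
      then show ?thesis unfolding im path_image_def[of g] image_Un[symmetric] by simp
    qed
    ultimately have "rtree r (insert (pathfinish g) (insert x V)) (S \<union> path_image g)"
      by (simp add: Un_assoc)
    then show ?thesis by blast
  qed
qed

lemma rtree_root_anywhere:
  assumes "rtree r V S" "x \<in> S"
  shows "\<exists>V'. rtree x V' S"
  using rtree_subdivide[OF assms] rtree_reroot by blast

lemma rtree_image:
  fixes f :: "'a::real_normed_vector \<Rightarrow> 'b::real_normed_vector"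
  assumes "rtree r V S" "continuous_on UNIV f" "inj f"
  shows "rtree (f r) (f ` V) (f ` S)"
  using assms
proof (induction)
  case root
  show ?case using rtree.root[of "f r"] by simp
next
  case (attach V S g)
  have "rtree (f r) (insert (pathfinish (f \<circ> g)) (f ` V)) (f ` S \<union> path_image (f \<circ> g))"
  proof (rule rtree.attach)
    show "arc (f \<circ> g)"
      using attach by (intro arc_continuous_image) (auto intro: continuous_on_subset inj_on_subset)
    have "path_image (f \<circ> g) \<inter> f ` S = f ` (path_image g \<inter> S)"
      using attach.prems by (simp add: path_image_compose image_Int)
    then show "path_image (f \<circ> g) \<inter> f ` S = {pathstart (f \<circ> g)}"
      using attach.hyps by (simp add: pathstart_compose)
  qed (use attach in \<open>auto simp: pathstart_compose\<close>)
  then show ?case by (simp add: pathfinish_compose path_image_compose image_Un)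
qed

section \<open>Lifting trees through quadratic maps\<close>

text \<open>The parameters with \<open>g t \<noteq> 0\<close> form a contractible set, so
  \<open>g\<close> has a continuous logarithm there, and halving it gives a square root.\<close>

lemma continuous_square_root_path:
  fixes g :: "real \<Rightarrow> complex"
  assumes "continuous_on {0..1} g" "convex {t \<in> {0..1}. g t \<noteq> 0}"
  obtains r where "continuous_on {0..1} r" "\<And>t. t \<in> {0..1} \<Longrightarrow> (r t)\<^sup>2 = g t"
proof -
  let ?Z = "{t \<in> {0..1}. g t \<noteq> 0}"
  have a: "continuous_on ?Z g" using assms(1) by (rule continuous_on_subset) auto
  have b: "contractible ?Z" using assms(2) by (rule convex_imp_contractible)
  have c: "\<And>t. t \<in> ?Z \<Longrightarrow> g t \<noteq> 0" by simp
  obtain h where h: "continuous_on ?Z h" "\<And>t. t \<in> ?Z \<Longrightarrow> g t = exp (h t)"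
    by (rule continuous_logarithm_on_contractible[OF a b c]) (assumption, rule that)
  define r where "r t = (if g t = 0 then 0 else exp (h t / 2))" for t
  have sq: "(r t)\<^sup>2 = g t" if "t \<in> {0..1}" for t
    using h(2)[of t] that by (auto simp: r_def exp_double[symmetric])
  have "continuous (at t within {0..1}) r" if t: "t \<in> {0..1}" for t
  proof (cases "g t = 0")
    case True
    \<comment> \<open>At a zero of \<open>g\<close> the modulus of \<open>r\<close> alone gives
      continuity, whatever branch is taken nearby.\<close>
    have "((\<lambda>s. sqrt (norm (g s))) \<longlongrightarrow> sqrt (norm (g t))) (at t within {0..1})"
      using assms(1) t by (intro tendsto_intros) (simp add: continuous_on_def)
    moreover have "\<forall>\<^sub>F s in at t within {0..1}. sqrt (norm (g s)) = norm (r s)"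
      using sq by (auto simp: eventually_at_filter norm_power simp flip: sq)
    ultimately have "((\<lambda>s. norm (r s)) \<longlongrightarrow> 0) (at t within {0..1})"
      using True by (auto elim: Lim_transform_eventually)
    then show ?thesis
      unfolding continuous_within using True by (auto simp: r_def[of t] intro: tendsto_norm_zero_cancel)
  next
    case False
    have "openin (top_of_set {0..1}) ({0..1} \<inter> g -` (- {0}))"
      using assms(1) by (intro continuous_openin_preimage_gen) auto
    moreover have "{0..1} \<inter> g -` (- {0}) = ?Z" by auto
    ultimately have o: "openin (top_of_set {0..1}) ?Z" by simp
    have "continuous_on ?Z (\<lambda>t. exp (h t / 2))" using h(1) by (intro continuous_intros) auto
    then have "continuous_on ?Z r"
      by (rule continuous_on_eq) (auto simp: r_def)
    then have "continuous (at t within ?Z) r" using False t by (simp add: continuous_on_eq_continuous_within)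
    \<comment> \<open>The nonvanishing set is relatively open, so continuity within it is continuity
      within the whole interval.\<close>
    moreover have "at t within ?Z = at t within {0..1}"
    proof -
      obtain A where A: "open A" "?Z = {0..1} \<inter> A" using o unfolding openin_open by blast
      then have "t \<in> A" using False t by blast
      then show ?thesis by (rule at_within_nhd) (use A in auto)
    qed
    ultimately show ?thesis by simp
  qed
  then have "continuous_on {0..1} r" by (simp add: continuous_on_eq_continuous_within)
  then show thesis using sq by (rule that)
qed

text \<open>Each arc \<open>g\<close> lifts to the two arcs \<open>r\<close> and \<open>- r\<close>,
  glued at the two square roots of its start. With the root at the branch point \<open>0\<close>,
  later arcs can meet \<open>0\<close> only at their start, where the two lifts then
  coincide.\<close>

lemma rtree_vimage_square:
  fixes V S :: "complex set"
  assumes "rtree 0 V S"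
  shows "rtree 0 {z. z\<^sup>2 \<in> V} {z. z\<^sup>2 \<in> S}"
  using assms
proof (induction)
  case root
  show ?case using rtree.root[of "0::complex"] by simp
next
  case (attach V S g)
  let ?p = "pathstart g"
  have 0: "0 \<in> S" using rtree_props[OF attach.hyps(1)] by blast
  have inj: "g s = g t \<longleftrightarrow> s = t" if "s \<in> {0..1}" "t \<in> {0..1}" for s t
    using attach.hyps that by (auto simp: arc_def inj_on_def)
  have gS: "g t \<in> S \<longleftrightarrow> t = 0" if "t \<in> {0..1}" for t
  proof -
    have "g t \<in> S \<longleftrightarrow> g t = g 0" using attach.hyps(4) that by (auto simp: path_image_def pathstart_def)
    then show ?thesis using inj that by auto
  qed
  \<comment> \<open>Since \<open>0\<close> already lies in \<open>S\<close>, the arc can vanish only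
    at parameter \<open>0\<close>; the nonvanishing set is therefore an interval.\<close>
  have "{t \<in> {0..1}. g t \<noteq> 0} = (if g 0 = 0 then {0<..1} else {0..1})"
  proof -
    have "t = 0" if "t \<in> {0..1}" "g t = 0" for t using 0 gS[OF that(1)] that(2) by simp
    then show ?thesis by (force simp: less_le)
  qed
  then have conv: "convex {t \<in> {0..1}. g t \<noteq> 0}" by auto
  have cont: "continuous_on {0..1} g"
    using attach.hyps(2) by (simp add: arc_def path_def)
  obtain r where r: "continuous_on {0..1} r" "\<And>t. t \<in> {0..1} \<Longrightarrow> (r t)\<^sup>2 = g t"
    by (rule continuous_square_root_path[OF cont conv]) (rule that)
  have arc_r: "arc r"
    using r(1) inj r(2) unfolding arc_def path_def inj_on_def by (metis (no_types))
  have r_eq: "s = t" if "(r s)\<^sup>2 = (r t)\<^sup>2" "s \<in> {0..1}" "t \<in> {0..1}" for s t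
    using that r(2) inj by metis
  let ?r' = "uminus \<circ> r"
  have arc_r': "arc ?r'"
    using arc_r by (intro arc_continuous_image) (auto intro!: continuous_intros)
  have start: "pathstart r = r 0" "pathfinish r = r 1" "pathstart ?r' = - r 0" "pathfinish ?r' = - r 1"
    by (auto simp: pathstart_def pathfinish_def)
  have im: "path_image r = r ` {0..1}" "path_image ?r' = (\<lambda>t. - r t) ` {0..1}"
    by (auto simp: path_image_def image_comp)
  have V0: "(r 0)\<^sup>2 \<in> V" "(r 0)\<^sup>2 \<in> S"
    using attach.hyps r(2)[of 0] gS[of 0] by (auto simp: pathstart_def)
  have "path_image r \<inter> {z. z\<^sup>2 \<in> S} = {pathstart r}"
    unfolding im start using gS r(2) V0 by auto
  then have 1: "rtree 0 (insert (r 1) {z. z\<^sup>2 \<in> V}) ({z. z\<^sup>2 \<in> S} \<union> path_image r)"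
    using rtree.attach[OF attach.IH arc_r] V0 start by simp
  have "path_image ?r' \<inter> ({z. z\<^sup>2 \<in> S} \<union> path_image r) = {pathstart ?r'}"
  proof -
    \<comment> \<open>If \<open>- r t = r s\<close>, squaring and injectivity of \<open>g\<close>
      give \<open>s = t\<close>, hence \<open>r t = 0\<close>. Then \<open>g t = 0\<close> lies in
      \<open>S\<close>, which happens only at the start.\<close>
    have "t = 0" if t: "t \<in> {0..1}" and "- r t \<in> {z. z\<^sup>2 \<in> S} \<union> path_image r" for t
      using that(2)
    proof
      assume "- r t \<in> {z. z\<^sup>2 \<in> S}"
      then show ?thesis using gS[OF t] r(2)[OF t] by simp
    next
      assume "- r t \<in> path_image r"
      then obtain s where s: "s \<in> {0..1}" "- r t = r s" by (auto simp: im)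
      then have "s = t" using r_eq t by (metis power2_minus)
      then have "r t = 0" using s(2) by simp
      then have "g t = 0" using r(2)[OF t] by simp
      then show ?thesis using gS[OF t] 0 by simp
    qed
    then have "path_image ?r' \<inter> ({z. z\<^sup>2 \<in> S} \<union> path_image r) \<subseteq> {- r 0}"
      unfolding im(2) by blast
    moreover have "- r 0 \<in> path_image ?r'" unfolding im(2) by auto
    ultimately show ?thesis unfolding start using V0 by auto
  qed
  then have "rtree 0 (insert (- r 1) (insert (r 1) {z. z\<^sup>2 \<in> V})) ({z. z\<^sup>2 \<in> S} \<union> path_image r \<union> path_image ?r')"
    using rtree.attach[OF 1 arc_r'] V0 start by simp
  moreover have "insert (- r 1) (insert (r 1) {z. z\<^sup>2 \<in> V}) = {z. z\<^sup>2 \<in> insert (pathfinish g) V}"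
    using r(2)[of 1] by (auto simp: pathfinish_def power2_eq_iff simp flip: r(2))
  moreover have "{z. z\<^sup>2 \<in> S} \<union> path_image r \<union> path_image ?r' = {z. z\<^sup>2 \<in> S \<union> path_image g}"
  proof -
    have "z \<in> path_image r \<union> path_image ?r' \<longleftrightarrow> z\<^sup>2 \<in> path_image g" for z
    proof
      assume "z\<^sup>2 \<in> path_image g"
      then obtain t where "t \<in> {0..1}" "z\<^sup>2 = (r t)\<^sup>2" using r(2) by (auto simp: path_image_def)
      then show "z \<in> path_image r \<union> path_image ?r'" by (auto simp: im power2_eq_iff)
    qed (use r(2) in \<open>auto simp: im path_image_def\<close>)
    then show ?thesis by blast
  qed
  ultimately show ?case by simp
qed

text \<open>The tree is rerooted at the critical value \<open>0\<close> and lifted through squaring;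
  the affine map \<open>z \<mapsto> (w - z) / 2\<close> carries the result to the preimage under
  \<open>quad w\<close>.\<close>

lemma rtree_vimage_quad:
  assumes "rtree r V S" "0 \<in> S"
  shows "\<exists>W. rtree (w / 2) W (quad w -` S)"
proof -
  obtain V' where "rtree 0 V' S" using rtree_root_anywhere[OF assms] by blast
  then have 1: "rtree 0 {z. z\<^sup>2 \<in> V'} {z. z\<^sup>2 \<in> S}" by (rule rtree_vimage_square)
  let ?f = "\<lambda>z. (w - z) / 2"
  have "continuous_on UNIV ?f" "inj ?f" by (auto intro!: continuous_intros injI)
  from rtree_image[OF 1 this] have "rtree (w / 2) (?f ` {z. z\<^sup>2 \<in> V'}) (?f ` {z. z\<^sup>2 \<in> S})" by simp
  moreover have "?f ` {z. z\<^sup>2 \<in> S} = quad w -` S"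
  proof
    show "?f ` {z. z\<^sup>2 \<in> S} \<subseteq> quad w -` S" by (auto simp: field_simps)
    show "quad w -` S \<subseteq> ?f ` {z. z\<^sup>2 \<in> S}"
    proof
      fix z assume "z \<in> quad w -` S"
      then show "z \<in> ?f ` {z. z\<^sup>2 \<in> S}" by (intro image_eqI[of _ _ "w - 2 * z"]) auto
    qed
  qed
  ultimately show ?thesis by auto
qed

section \<open>Realising arc trees as simplicial trees in three-space\<close>

text \<open>Seen from \<open>p\<close>, every simplex spans at most a plane. Finitely many planes
  are negligible in three-space and cannot exhaust the directions.\<close>

lemma direction_avoiding_simplices:
  fixes K :: "(real^3) set set"
  assumes "graph_complex K"
  obtains d where "\<And>S. S \<in> K \<Longrightarrow> d \<notin> span ((\<lambda>x. x - p) ` S)"  "d \<noteq> 0"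
proof -
  interpret graph_complex K by fact
  have "negligible (span ((\<lambda>x. x - p) ` S))" if SK: "S \<in> K" for S
  proof (rule negligible_lowdim)
    have "dim ((\<lambda>x. x - p) ` S) \<le> 2"
    proof (cases "S = {}")
      case False
      then obtain a b where S: "S = closed_segment a b" using simplex_cases[OF SK] by blast
      have "(\<lambda>x. x - p) ` S \<subseteq> span {a - p, b - p}"
      proof (clarsimp simp: S in_segment)
        fix u :: real
        have "(1 - u) *\<^sub>R a + u *\<^sub>R b - p = (1 - u) *\<^sub>R (a - p) + u *\<^sub>R (b - p)"
          by (simp add: algebra_simps)
        then show "(1 - u) *\<^sub>R a + u *\<^sub>R b - p \<in> span {a - p, b - p}"
          by (simp add: span_add span_scale span_base)
      qed
      then have "dim ((\<lambda>x. x - p) ` S) \<le> card {a - p, b - p}" by (rule dim_le_card) simp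
      also have "\<dots> \<le> 2" by (simp add: card_insert_if)
      finally show ?thesis .
    qed simp
    then show "dim (span ((\<lambda>x. x - p) ` S)) < DIM(real^3)" by simp
  qed
  \<comment> \<open>The added empty set contributes the zero subspace, which forces
    \<open>d \<noteq> 0\<close>.\<close>
  then have "negligible (\<Union>S\<in>insert {} K. span ((\<lambda>x. x - p) ` S))"
    using finite_K by (intro negligible_Union) auto
  then have "(\<Union>S\<in>insert {} K. span ((\<lambda>x. x - p) ` S)) \<noteq> UNIV"
    using non_negligible_UNIV by metis
  then obtain d where d: "d \<notin> (\<Union>S\<in>insert {} K. span ((\<lambda>x. x - p) ` S))" by blast
  show thesis
  proof (rule that)
    show "d \<notin> span ((\<lambda>x. x - p) ` S)" if "S \<in> K" for S using d that by blast
    show "d \<noteq> 0" using d by simp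
  qed
qed

text \<open>The new edge leaves \<open>p\<close> in a generic direction and so touches the complex
  nowhere else. Its far end \<open>q\<close> is a leaf, so it creates no cycle.\<close>

lemma simplicial_tree_attach_edge:
  fixes K :: "(real^3) set set"
  assumes tree: "simplicial_tree K" and p: "p \<in> cx_vertices K"
  obtains q where "p \<noteq> q" "closed_segment p q \<inter> \<Union>K = {p}"
    "simplicial_tree (insert {q} (insert (closed_segment p q) K))"
    "cx_vertices (insert {q} (insert (closed_segment p q) K)) = insert q (cx_vertices K)"
proof -
  have cx: "graph_complex K" using tree by unfold_locales (auto simp: simplicial_tree_def)
  interpret graph_complex K by fact
  obtain d where d: "\<And>S. S \<in> K \<Longrightarrow> d \<notin> span ((\<lambda>x. x - p) ` S)" "d \<noteq> 0"
    by (rule direction_avoiding_simplices[OF cx, of p]) (rule that)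
  define q where "q = p + d"
  let ?e = "closed_segment p q"
  let ?K = "insert {q} (insert ?e K)"
  have pq: "p \<noteq> q" using d(2) by (simp add: q_def)
  \<comment> \<open>A second common point would make \<open>d\<close> a multiple of
    \<open>y - p\<close>, against the choice of \<open>d\<close>.\<close>
  have e_Int: "y = p" if S: "S \<in> K" "y \<in> S" "y \<in> ?e" for S y
  proof (rule ccontr)
    assume "y \<noteq> p"
    obtain u where "y = (1 - u) *\<^sub>R p + u *\<^sub>R q" using S(3) by (auto simp: in_segment)
    then have u: "y - p = u *\<^sub>R d" by (simp add: q_def algebra_simps)
    then have "u \<noteq> 0" using \<open>y \<noteq> p\<close> by auto
    then have "d = (1 / u) *\<^sub>R (y - p)" using u by simp
    moreover have "y - p \<in> span ((\<lambda>x. x - p) ` S)" using S(2) by (intro span_base) auto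
    ultimately have "d \<in> span ((\<lambda>x. x - p) ` S)" using span_scale by metis
    then show False using d(1)[OF S(1)] by simp
  qed
  have pK: "{p} \<in> K" using p by (simp add: cx_vertices_def)
  then have empty: "{} \<in> K" using face_in_K empty_face_of by blast
  have qK: "q \<notin> S" if "S \<in> K" for S using e_Int[OF that, of q] pq by auto
  have faces_e: "{p} face_of ?e" "{q} face_of ?e"
    unfolding face_of_singleton extreme_point_of_segment by auto
  have S_e: "S \<inter> ?e = {} \<or> S \<inter> ?e = {p} \<and> p \<in> S" if "S \<in> K" for S
    using e_Int[OF that] by fastforce
  have complex': "simplicial_complex ?K"
    unfolding simplicial_complex_def
  proof (intro conjI ballI allI impI)
    show "finite ?K" using finite_K by simp
    show "\<exists>n. n simplex S" if "S \<in> ?K" for S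
      using that is_simplex simplex_segment by (metis insert_iff closed_segment_idem)
  next
    fix F S assume "S \<in> ?K \<and> F face_of S"
    then consider "S \<in> K" "F face_of S" | "F face_of closed_segment q q" | "F face_of ?e" by auto
    then show "F \<in> ?K"
    proof cases
      case 1
      then show ?thesis using face_in_K by blast
    next
      case 2
      then show ?thesis using face_of_closed_segment_cases[OF 2] empty by auto
    next
      case 3
      then show ?thesis using face_of_closed_segment_cases[OF 3] empty pK by auto
    qed
  next
    fix S S' assume SS: "S \<in> ?K \<and> S' \<in> ?K"
    have e_face: "(S \<inter> ?e) face_of S" "(S \<inter> ?e) face_of ?e" if "S \<in> K" for S
    proof -
      have "{p} face_of S" if "p \<in> S" using Int_face[OF \<open>S \<in> K\<close> pK] that by simp
      then show "(S \<inter> ?e) face_of S" "(S \<inter> ?e) face_of ?e"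
        using S_e[OF that] faces_e by (elim disjE conjE; simp)+
    qed
    consider "S \<in> K" "S' \<in> K" | "S \<in> K" "S' = {q}" | "S \<in> K" "S' = ?e" | "S = {q}"
      | "S = ?e" "S' \<in> K" | "S = ?e" "S' = {q}" | "S = ?e" "S' = ?e"
      using SS by blast
    then show "(S \<inter> S') face_of S"
    proof cases
      case 1
      then show ?thesis by (rule Int_face)
    next
      case 2
      then have "S \<inter> S' = {}" using qK by auto
      then show ?thesis by simp
    next
      case 3
      then show ?thesis using e_face(1) by blast
    next
      case 4
      then have "S \<inter> S' = {} \<or> S \<inter> S' = S" by blast
      moreover have "S face_of S" using 4 by (simp add: face_of_refl_eq)
      ultimately show ?thesis by fastforce
    next
      case 5
      then show ?thesis using e_face(2) by (simp add: Int_commute)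
    next
      case 6
      then have "S \<inter> S' = {q}" by auto
      then show ?thesis using faces_e 6 by simp
    next
      case 7
      then show ?thesis by (simp add: face_of_refl_eq)
    qed
  qed
  have dim': "aff_dim S \<le> 1" if "S \<in> ?K" for S
  proof -
    have "aff_dim ?e = 1" using one_simplex_segment[OF pq] aff_dim_simplex by blast
    then show ?thesis using that dim by auto
  qed
  have vertices': "cx_vertices ?K = insert q (cx_vertices K)"
    using pq by (auto simp: cx_vertices_def closed_segment_eq_sing eq_commute[of "{_}" "closed_segment _ _"])
  have adj': "cx_adj ?K = insert (p, q) (insert (q, p) (cx_adj K))"
    using pq by (auto simp: cx_adj_def closed_segment_eq_sing doubleton_eq_iff)
  have adj_q: "(q, x) \<notin> cx_adj K" "(x, q) \<notin> cx_adj K" for x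
    using qK by (auto simp: cx_adj_def)
  have mono: "(v, w) \<in> (cx_adj ?K)\<^sup>*" if "v \<in> cx_vertices K" "w \<in> cx_vertices K" for v w
  proof -
    have "(v, w) \<in> (cx_adj K)\<^sup>*" using tree that by (auto simp: simplicial_tree_def)
    then show ?thesis using rtrancl_mono[of "cx_adj K" "cx_adj ?K"] adj' by blast
  qed
  have pq_adj: "(p, q) \<in> cx_adj ?K" "(q, p) \<in> cx_adj ?K" using adj' by auto
  have conn': "(v, w) \<in> (cx_adj ?K)\<^sup>*" if "v \<in> cx_vertices ?K" "w \<in> cx_vertices ?K" for v w
  proof -
    have "(v, p) \<in> (cx_adj ?K)\<^sup>*" using that(1) mono p pq_adj by (auto simp: vertices')
    moreover have "(p, w) \<in> (cx_adj ?K)\<^sup>*" using that(2) mono p pq_adj by (auto simp: vertices')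
    ultimately show ?thesis by simp
  qed
  have acyclic': "\<not> (\<exists>vs. length vs \<ge> 3 \<and> distinct vs \<and>
          (\<forall>i<length vs. (vs ! i, vs ! (Suc i mod length vs)) \<in> cx_adj ?K))"
  proof
    assume "\<exists>vs. length vs \<ge> 3 \<and> distinct vs \<and>
          (\<forall>i<length vs. (vs ! i, vs ! (Suc i mod length vs)) \<in> cx_adj ?K)"
    then obtain vs where vs: "length vs \<ge> 3" "distinct vs"
      "\<And>i. i < length vs \<Longrightarrow> (vs ! i, vs ! (Suc i mod length vs)) \<in> cx_adj ?K" by blast
    let ?n = "length vs"
    show False
    proof (cases "q \<in> set vs")
      case False
      have "(vs ! i, vs ! (Suc i mod ?n)) \<in> cx_adj K" if "i < ?n" for i
      proof -
        have "Suc i mod ?n < ?n" using vs(1) by (intro mod_less_divisor) auto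
        then have "vs ! i \<noteq> q" "vs ! (Suc i mod ?n) \<noteq> q"
          using False that nth_mem by blast+
        then show ?thesis using vs(3)[OF that] adj' by auto
      qed
      then show False using tree vs(1,2) unfolding simplicial_tree_def by blast
    next
      case True
      then obtain i where i: "i < ?n" "vs ! i = q" by (auto simp: in_set_conv_nth)
      \<comment> \<open>The cyclic predecessor of \<open>i\<close>. Since \<open>q\<close> is
        adjacent only to \<open>p\<close>, both neighbours of \<open>q\<close> on the cycle are
        \<open>p\<close>; distinctness identifies their positions, which is impossible for length at
        least 3.\<close>
      define j where "j = (if i = 0 then ?n - 1 else i - 1)"
      have j: "j < ?n" "Suc j mod ?n = i" using i vs(1) by (auto simp: j_def)
      have "vs ! (Suc i mod ?n) = p" using vs(3)[OF i(1)] i(2) adj' adj_q pq by auto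
      moreover have "vs ! j = p" using vs(3)[OF j(1)] j(2) i(2) adj' adj_q pq by auto
      moreover have "Suc i mod ?n < ?n" using vs(1) by (intro mod_less_divisor) auto
      ultimately have "Suc i mod ?n = j" using vs(2) j(1) nth_eq_iff_index_eq by metis
      then show False
        using i(1) vs(1) by (cases "Suc i = ?n") (auto simp: j_def split: if_splits)
    qed
  qed
  have "simplicial_tree ?K"
    unfolding simplicial_tree_def
    by (intro conjI ballI complex' dim' conn' acyclic') (simp_all add: vertices')
  moreover have "?e \<inter> \<Union>K = {p}" using e_Int pK by auto
  ultimately show thesis using that[OF pq _ _ vertices'] by blast
qed

lemma simplicial_tree_point: "simplicial_tree {{}, {a :: 'a::euclidean_space}}"
proof -
  have "F = {} \<or> F = {a}" if "F face_of {a}" for F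
    using that face_of_imp_subset by blast
  then have "simplicial_complex {{}, {a}}"
    by (auto simp: simplicial_complex_def face_of_refl_eq)
  moreover have "cx_vertices {{}, {a}} = {a}" by (auto simp: cx_vertices_def)
  moreover have "cx_adj {{}, {a}} = {}" by (auto simp: cx_adj_def closed_segment_eq_sing)
  ultimately show ?thesis by (auto simp: simplicial_tree_def) (metis gr_zeroI length_0_conv list.size(3) not_numeral_le_zero)
qed

lemma rtree_realisation:
  fixes S :: "'a::real_normed_vector set"
  assumes "rtree r V S"
  shows "\<exists>(K :: (real^3) set set) h k. simplicial_tree K \<and> homeomorphism S (\<Union>K) h k \<and> h ` V \<subseteq> cx_vertices K"
  using assms
proof (induction)
  case root
  have "homeomorphism {r} (\<Union>{{}, {0}}) (\<lambda>_. 0 :: real^3) (\<lambda>_. r)"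
    by (auto simp: homeomorphism_def)
  then show ?case
    using simplicial_tree_point[of "0 :: real^3"] by (intro exI conjI) (auto simp: cx_vertices_def)
next
  case (attach V S g)
  then obtain K :: "(real^3) set set" and h k where K: "simplicial_tree K" "homeomorphism S (\<Union>K) h k"
    "h ` V \<subseteq> cx_vertices K" by blast
  let ?p = "h (pathstart g)"
  obtain q where q: "?p \<noteq> q" "closed_segment ?p q \<inter> \<Union>K = {?p}"
    "simplicial_tree (insert {q} (insert (closed_segment ?p q) K))"
    "cx_vertices (insert {q} (insert (closed_segment ?p q) K)) = insert q (cx_vertices K)"
    using simplicial_tree_attach_edge[OF K(1), of ?p] K(3) attach.hyps by blast
  let ?K = "insert {q} (insert (closed_segment ?p q) K)"
  let ?A = "path_image g"
  obtain gi where gi: "homeomorphism {0..1} ?A g gi"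
    using homeomorphism_arc[OF attach.hyps(2)] by blast
  \<comment> \<open>The parameter of the arc is transported to the new edge; at the gluing point
    this agrees with \<open>h\<close>, so the two maps can be pasted.\<close>
  define l where "l = linepath ?p q \<circ> gi"
  have l_cont: "continuous_on ?A l"
    unfolding l_def using gi by (intro continuous_on_compose) (auto simp: homeomorphism_def)
  have l_inj: "inj_on l ?A"
  proof -
    have "inj_on gi ?A" using gi by (metis homeomorphism_def inj_on_inverseI)
    moreover have "inj_on (linepath ?p q) (gi ` ?A)"
      using arc_linepath[OF q(1)] gi by (simp add: arc_def homeomorphism_def)
    ultimately show ?thesis unfolding l_def by (rule comp_inj_on)
  qed
  have l_im: "l ` ?A = closed_segment ?p q"
    using gi unfolding l_def image_comp[symmetric] homeomorphism_def
    by (metis path_image_def path_image_linepath)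
  have gi01: "gi (pathstart g) = 0" "gi (pathfinish g) = 1"
    using gi by (auto simp: homeomorphism_def pathstart_def pathfinish_def)
  then have l_ends: "l (pathstart g) = ?p" "l (pathfinish g) = q"
    by (auto simp: l_def linepath_def)
  define h' where "h' x = (if x \<in> S then h x else l x)" for x
  have h_im: "h ` S = \<Union>K" and h_inj: "inj_on h S" and h_cont: "continuous_on S h"
    using K(2) by (auto simp: homeomorphism_def intro: inj_on_inverseI)
  have SA: "x = pathstart g" if "x \<in> S" "x \<in> ?A" for x using attach.hyps(4) that by blast
  have h'_S: "h' x = h x" if "x \<in> S" for x using that by (simp add: h'_def)
  have h'_A: "h' x = l x" if "x \<in> ?A" for x using that SA l_ends by (auto simp: h'_def)
  have comp: "compact S" "compact ?A"
    using rtree_props(3)[OF attach.hyps(1)] attach.hyps(2) by (auto intro: compact_path_image arc_imp_path)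
  have "continuous_on (S \<union> ?A) h'"
  proof (rule continuous_on_closed_Un)
    show "continuous_on S h'" using h_cont by (rule continuous_on_eq) (simp add: h'_S)
    show "continuous_on ?A h'" using l_cont by (rule continuous_on_eq) (simp add: h'_A)
  qed (use comp in \<open>auto intro: compact_imp_closed\<close>)
  moreover have "h' ` (S \<union> ?A) = \<Union>?K"
  proof -
    have "h' ` S = \<Union>K" using h_im h'_S by (auto simp: image_iff)
    moreover have "h' ` ?A = closed_segment ?p q" using l_im h'_A by (auto simp: image_iff)
    ultimately show ?thesis by (simp add: image_Un insert_absorb) blast
  qed
  moreover have "inj_on h' (S \<union> ?A)"
  proof -
    have *: "x = y" if "x \<in> S" "y \<in> ?A" "h x = l y" for x y
    proof -
      have "h x \<in> closed_segment ?p q \<inter> \<Union>K"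
        using imageI[OF that(1), of h] imageI[OF that(2), of l] that(3) unfolding h_im l_im by simp
      then have "h x = ?p" using q(2) by blast
      then have "l y = l (pathstart g)" using that l_ends by simp
      then have y: "y = pathstart g" using l_inj that by (auto dest: inj_onD)
      have "pathstart g \<in> S" using attach.hyps(4) by blast
      then show ?thesis using y \<open>h x = ?p\<close> h_inj that by (auto dest: inj_onD)
    qed
    show ?thesis
    proof (rule inj_onI)
      fix x y assume xy: "x \<in> S \<union> ?A" "y \<in> S \<union> ?A" "h' x = h' y"
      consider "x \<in> S" "y \<in> S" | "x \<in> ?A" "y \<in> ?A" | "x \<in> S" "y \<in> ?A" | "x \<in> ?A" "y \<in> S"
        using xy by blast
      then show "x = y"
      proof cases
        case 1
        then show ?thesis using xy h_inj by (simp add: h'_S inj_on_eq_iff)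
      next
        case 2
        then show ?thesis using xy l_inj by (simp add: h'_A inj_on_eq_iff)
      next
        case 3
        then show ?thesis using xy * by (simp add: h'_S h'_A)
      next
        case 4
        then show ?thesis using xy * by (metis h'_S h'_A)
      qed
    qed
  qed
  ultimately obtain k' where "homeomorphism (S \<union> ?A) (\<Union>?K) h' k'"
    using homeomorphism_compact comp compact_Un by metis
  moreover have "h' ` insert (pathfinish g) V \<subseteq> cx_vertices ?K"
  proof -
    have "h' (pathfinish g) = q" using h'_A[of "pathfinish g"] l_ends by (simp add: pathfinish_in_path_image)
    moreover have "V \<subseteq> S" using rtree_props(2)[OF attach.hyps(1)] .
    then have "h' ` V \<subseteq> cx_vertices K" using K(3) h'_S by (auto simp: subset_iff)
    ultimately show ?thesis unfolding q(4) by auto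
  qed
  ultimately show ?case using q(3) by blast
qed

section \<open>Julia sets of the fibres\<close>

lemma vector_3_nonzero: "(z, w, u) \<noteq> (0, 0, 0) \<Longrightarrow> (vector [z, w, u] :: complex^3) \<noteq> 0"
  by (auto simp: vec_eq_iff forall_3)

lemma cproj_cases:
  fixes p :: "('n::finite) cproj"
  obtains v where "v \<noteq> 0" "p = abs_cproj v"
  using Quotient_abs_rep[OF Quotient_cproj, of p] Quotient_rep_reflp[OF Quotient_cproj, of p]
  by metis

lemma pt2_cases:
  obtains w u where "(w, u) \<noteq> (0, 0)" "p = pt2 w u"
proof -
  obtain v where v: "v \<noteq> 0" "p = abs_cproj v" by (rule cproj_cases)
  have "v = vector [v$1, v$2]" by (simp add: vec_eq_iff forall_2)
  moreover have "(v$1, v$2) \<noteq> (0, 0)" using v(1) by (auto simp: vec_eq_iff forall_2)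
  ultimately show thesis using that v(2) unfolding pt2_def by metis
qed

lemma continuous_on_abs_cproj:
  fixes g :: "'a::topological_space \<Rightarrow> complex ^ ('n::finite)"
  assumes "continuous_on S g" "\<And>x. x \<in> S \<Longrightarrow> g x \<noteq> 0"
  shows "continuous_on S (\<lambda>x. abs_cproj (g x))"
proof -
  have "continuous_on (- {0}) (abs_cproj :: complex^'n \<Rightarrow> 'n cproj)"
  proof (subst continuous_on_open_vimage)
    show "open (- {0 :: complex^'n})" by auto
    have "abs_cproj -` B \<inter> - {0} = {v :: complex^'n. v \<noteq> 0 \<and> abs_cproj v \<in> B}" for B by auto
    then show "\<forall>B. open B \<longrightarrow> open (abs_cproj -` B \<inter> - {0 :: complex^'n})"
      by (simp add: open_cproj_def)
  qed
  then show ?thesis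
    by (rule continuous_on_compose2) (use assms in auto)
qed

lemma continuous_on_vector_3:
  fixes f g h :: "'a::topological_space \<Rightarrow> complex"
  assumes "continuous_on S f" "continuous_on S g" "continuous_on S h"
  shows "continuous_on S (\<lambda>x. vector [f x, g x, h x] :: complex^3)"
proof -
  have eq: "(vector [a, b, c] :: complex^3) = (\<chi> i. if i = 1 then a else if i = 2 then b else c)" for a b c
    by (simp add: vec_eq_iff forall_3)
  have "continuous_on S (\<lambda>x. if i = 1 then f x else if i = 2 then g x else h x)" for i :: 3
    using assms by (cases "i = 1"; cases "i = 2"; simp)
  then show ?thesis unfolding eq by (intro continuous_on_vec_lambda)
qed

text \<open>A scaling-invariant condition on vectors is its own preimage under projectivisation, so
  openness can be checked on vectors.\<close>

lemma open_cproj_homogeneous: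
  fixes P :: "complex ^ ('n::finite) \<Rightarrow> bool"
  assumes "open {v. v \<noteq> 0 \<and> P v}" "\<And>c v. c \<noteq> 0 \<Longrightarrow> P v \<Longrightarrow> P (c *s v)"
  shows "open {p. \<exists>v. v \<noteq> 0 \<and> p = abs_cproj v \<and> P v}"
proof -
  have "{v. v \<noteq> 0 \<and> abs_cproj v \<in> {p. \<exists>v. v \<noteq> 0 \<and> p = abs_cproj v \<and> P v}} = {v. v \<noteq> 0 \<and> P v}"
  proof (intro Collect_cong conj_cong refl iffI)
    fix v :: "complex^'n" assume "v \<noteq> 0" "abs_cproj v \<in> {p. \<exists>v. v \<noteq> 0 \<and> p = abs_cproj v \<and> P v}"
    then obtain x where x: "x \<noteq> 0" "abs_cproj x = abs_cproj v" "P x" by auto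
    then obtain c where "c \<noteq> 0" "v = c *s x" using abs_cproj_eq_iff \<open>v \<noteq> 0\<close> by metis
    then show "P v" using assms(2) x(3) by simp
  qed auto
  then show ?thesis unfolding open_cproj_def using assms(1) by simp
qed

text \<open>The affine coordinate \<open>z\<close> depends on the representative
  \<open>(w, u)\<close>: multiplying the pair by a nonzero constant multiplies this set by the same
  constant.\<close>

definition fibre :: "complex \<Rightarrow> complex \<Rightarrow> complex set" where
  "fibre w u = {z. pt3 z w u \<in> julia}"

lemma wline_pt2:
  assumes "(w, u) \<noteq> (0, 0)"
  shows "wline (pt2 w u) = range (\<lambda>z. pt3 z w u)"
proof (intro equalityI subsetI)
  fix p assume "p \<in> wline (pt2 w u)"
  then obtain z w' u' where p: "(w', u') \<noteq> (0, 0)" "p = pt3 z w' u'" "pt2 w' u' = pt2 w u"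
    by (auto simp: wline_def)
  then obtain c where c: "c \<noteq> 0" "w = c * w'" "u = c * u'" using pt2_eq_iff assms by metis
  then have "p = pt3 (c * z) w u" using p assms by (subst p(2), subst pt3_eq_iff) auto
  then show "p \<in> range (\<lambda>z. pt3 z w u)" by blast
qed (use assms in \<open>auto simp: wline_def\<close>)

text \<open>The parametrisation of the line by \<open>z\<close> is continuous and injective. It is
  open onto the line because \<open>z\<close> is recovered by a continuous formula that is
  homogeneous of degree zero.\<close>

lemma julia_wline_homeomorphic_fibre:
  assumes wu: "(w, u) \<noteq> (0, 0)"
  shows "(julia \<inter> wline (pt2 w u)) homeomorphic (fibre w u)"
proof -
  let ?i = "\<lambda>z. pt3 z w u"
  define N where "N = w * cnj w + u * cnj u"
  have N: "N \<noteq> 0"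
  proof -
    have "N = of_real ((cmod w)\<^sup>2 + (cmod u)\<^sup>2)"
      unfolding N_def by (simp only: complex_norm_square of_real_add)
    moreover have "(cmod w)\<^sup>2 + (cmod u)\<^sup>2 \<noteq> 0" using wu by (auto simp: sum_power2_eq_zero_iff)
    ultimately show ?thesis by (simp only: of_real_eq_0_iff not_False_eq_True)
  qed
  \<comment> \<open>The Hermitian product with \<open>(w, u)\<close>, whose squared norm is
    \<open>N\<close>. For \<open>v = c *s vector [z, w, u]\<close> it equals \<open>c * N\<close>,
    so \<open>v$1 * N / D v\<close> is \<open>z\<close>, with no case distinction on whether
    \<open>w\<close> or \<open>u\<close> vanishes.\<close>
  define D where "D v = v$2 * cnj w + v$3 * cnj u" for v :: "complex^3"
  have Dc: "continuous_on UNIV D" unfolding D_def by (intro continuous_intros)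
  have Ds: "D (c *s v) = c * D v" for c v by (simp add: D_def algebra_simps)
  have "continuous_on UNIV ?i"
    unfolding pt3_def using wu
    by (intro continuous_on_abs_cproj continuous_on_vector_3 continuous_intros vector_3_nonzero) auto
  moreover have "inj ?i"
    using wu by (intro injI, subst (asm) pt3_eq_iff) auto
  moreover have "openin (top_of_set (wline (pt2 w u))) (?i ` A)" if "openin (top_of_set UNIV) A" for A
  proof -
    have A: "open A" using that by simp
    let ?P = "\<lambda>v. D v \<noteq> 0 \<and> v$1 * N / D v \<in> A"
    let ?B = "{p. \<exists>v. v \<noteq> 0 \<and> p = abs_cproj v \<and> ?P v}"
    have "continuous_on {v. D v \<noteq> 0} (\<lambda>v. v$1 * N / D v)"
      using continuous_on_subset[OF Dc] by (intro continuous_intros) auto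
    moreover have "open {v. D v \<noteq> 0}"
      using Dc by (intro open_Collect_neq) auto
    ultimately have "open ((\<lambda>v. v$1 * N / D v) -` A \<inter> {v. D v \<noteq> 0})"
      using A continuous_on_open_vimage by blast
    also have "(\<lambda>v. v$1 * N / D v) -` A \<inter> {v. D v \<noteq> 0} = {v. v \<noteq> 0 \<and> ?P v}"
      by (auto simp: D_def)
    finally have "open ?B"
      by (intro open_cproj_homogeneous) (auto simp: Ds)
    moreover have "?i ` A = wline (pt2 w u) \<inter> ?B"
    proof -
      have "?i z \<in> ?B \<longleftrightarrow> z \<in> A" for z
      proof
        assume "z \<in> A"
        moreover have "D (vector [z, w, u]) = N" by (simp add: D_def N_def)
        ultimately show "?i z \<in> ?B"
          unfolding pt3_def using N wu vector_3_nonzero[of z w u]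
          by (auto intro!: exI[of _ "vector [z, w, u]"])
      next
        assume "?i z \<in> ?B"
        then obtain v where v: "v \<noteq> 0" "abs_cproj (vector [z, w, u]) = abs_cproj v" "?P v"
          unfolding pt3_def by blast
        moreover have "(vector [z, w, u] :: complex^3) \<noteq> 0" using wu by (intro vector_3_nonzero) auto
        ultimately obtain c where c: "c \<noteq> 0" "v = c *s vector [z, w, u]"
          using abs_cproj_eq_iff by blast
        have "D v = c * N" unfolding c Ds by (simp add: D_def N_def)
        then show "z \<in> A" using v(3) c N by simp
      qed
      then show ?thesis unfolding wline_pt2[OF wu] by auto
    qed
    ultimately show ?thesis by (simp add: openin_open_Int)
  qed
  ultimately obtain g where "homeomorphism UNIV (wline (pt2 w u)) ?i g"
    using homeomorphism_injective_open_map[of UNIV ?i] wline_pt2[OF wu] by metis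
  then have "homeomorphism (fibre w u) (julia \<inter> wline (pt2 w u)) ?i g"
    by (rule homeomorphism_of_subsets) (auto simp: fibre_def wline_pt2[OF wu])
  then show ?thesis using homeomorphic_def homeomorphic_sym by blast
qed

section \<open>Dynamics on the lines and the Julia set over the fixed line\<close>

lemma f_map_in_basin_iff: "f_map p \<in> basin \<longleftrightarrow> p \<in> basin"
  unfolding basin_def mem_Collect_eq funpow_swap1
  by (subst filterlim_sequentially_Suc[symmetric]) (simp add: funpow_swap1)

lemma fibre_eq_vimage:
  assumes "(w, u) \<noteq> (0, 0)"
  shows "fibre w u = quad w -` fibre (quad w u) (w\<^sup>2)"
proof -
  have "pt3 z w u \<in> julia \<longleftrightarrow> pt3 (quad w z) (quad w u) (w\<^sup>2) \<in> julia" for z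
    using f_map_in_basin_iff[of "pt3 z w u"] f_map_pt3[of z w u] assms by (auto simp: julia_def)
  then show ?thesis by (auto simp: fibre_def)
qed

text \<open>The points whose first coordinate strictly dominates the other two form an open
  neighbourhood of the attracting point, and the orbit never enters it.\<close>

lemma not_in_basin:
  assumes "\<And>n. \<exists>z w u. (w, u) \<noteq> (0, 0) \<and> (f_map ^^ n) p = pt3 z w u \<and> norm z \<le> max (norm w) (norm u)"
  shows "p \<in> julia"
proof -
  let ?P = "\<lambda>v :: complex^3. norm (v$2) < norm (v$1) \<and> norm (v$3) < norm (v$1)"
  let ?B = "{p. \<exists>v. v \<noteq> 0 \<and> p = abs_cproj v \<and> ?P v}"
  have P: "?P (c *s v) \<longleftrightarrow> ?P v" if "c \<noteq> 0" for c v
    using that by (auto simp: norm_mult)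
  have "open {v :: complex^3. ?P v}"
    by (intro open_Collect_conj open_Collect_less continuous_intros)
  moreover have "{v. ?P v} = {v. v \<noteq> 0 \<and> ?P v}" by auto
  ultimately have "open ?B"
    using P by (intro open_cproj_homogeneous) auto
  moreover have "pt3 1 0 0 \<in> ?B"
    unfolding pt3_def by (auto intro!: exI[of _ "vector [1, 0, 0]"] simp: vec_eq_iff forall_3)
  moreover have "(f_map ^^ n) p \<notin> ?B" for n
  proof
    assume "(f_map ^^ n) p \<in> ?B"
    moreover obtain z w u where z: "(w, u) \<noteq> (0, 0)" "(f_map ^^ n) p = pt3 z w u" "norm z \<le> max (norm w) (norm u)"
      using assms by blast
    ultimately obtain v where v: "v \<noteq> 0" "abs_cproj v = abs_cproj (vector [z, w, u])" "?P v"
      unfolding pt3_def by auto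
    moreover have "(vector [z, w, u] :: complex^3) \<noteq> 0" using z by (intro vector_3_nonzero) auto
    ultimately obtain c where "c \<noteq> 0" "vector [z, w, u] = c *s v"
      using abs_cproj_eq_iff by blast
    then have "?P (vector [z, w, u])" using P v(3) by metis
    then show False using z(3) by (simp add: max_def split: if_splits)
  qed
  ultimately have "\<not> (\<lambda>n. (f_map ^^ n) p) \<longlonglongrightarrow> pt3 1 0 0"
    by (metis (no_types, lifting) topological_tendstoD eventually_sequentially le_refl)
  then show ?thesis unfolding julia_def basin_def by blast
qed

text \<open>The lines \<open>z = 0\<close>, \<open>z = u\<close> and \<open>z = w\<close> are mapped as \<open>0 \<rightarrow> u \<rightarrow> w \<rightarrow> u\<close>.\<close>

lemma mem_fibre:
  assumes "(w, u) \<noteq> (0, 0)"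
  shows "0 \<in> fibre w u" "u \<in> fibre w u" "w \<in> fibre w u"
proof -
  have "\<exists>z' w' u'. (w', u') \<noteq> (0, 0) \<and> (f_map ^^ n) (pt3 z w u) = pt3 z' w' u' \<and>
      z' \<in> {0, u', w'}" if "z \<in> {0, u, w}" for z n
  proof (induction n)
    case 0
    show ?case using assms that by auto
  next
    case (Suc n)
    then obtain z' w' u' where *: "(w', u') \<noteq> (0, 0)" "(f_map ^^ n) (pt3 z w u) = pt3 z' w' u'"
      "z' \<in> {0, u', w'}" by blast
    have "(f_map ^^ Suc n) (pt3 z w u) = pt3 (quad w' z') (quad w' u') (w'\<^sup>2)"
      using * f_map_pt3[of z' w' u'] by auto
    moreover have "(quad w' u', w'\<^sup>2) \<noteq> (0, 0)" using *(1) by auto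
    moreover have "quad w' z' \<in> {0, w'\<^sup>2, quad w' u'}" using *(3) by auto
    ultimately show ?case by blast
  qed
  moreover have "norm z' \<le> max (norm w') (norm u')" if "z' \<in> {0, u', w'}" for z' w' u' :: complex
    using that by (auto simp: max_def)
  ultimately have "z \<in> fibre w u" if "z \<in> {0, u, w}" for z
    unfolding fibre_def mem_Collect_eq using that by (intro not_in_basin) meson
  then show "0 \<in> fibre w u" "u \<in> fibre w u" "w \<in> fibre w u" by auto
qed

text \<open>On the line \<open>w = u\<close> the map is \<open>z \<mapsto> (1 - 2 z)\<^sup>2\<close>, which doubles \<open>t\<close> in \<open>z = cos\<^sup>2 t\<close>.\<close>

lemma f_map_iterate_cos:
  "(f_map ^^ n) (pt3 ((cos t)\<^sup>2) 1 1) = pt3 ((cos (2 ^ n * t))\<^sup>2) 1 1"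
proof (induction n)
  case (Suc n)
  have "(1 - 2 * (cos (2 ^ n * t))\<^sup>2)\<^sup>2 = (cos (2 ^ Suc n * t))\<^sup>2"
    by (simp add: cos_double_cos power2_commute mult.assoc)
  then show ?case using Suc by (simp add: f_map_pt3)
qed simp

lemma tendsto_pt3_infinity:
  assumes "filterlim a at_infinity sequentially"
  shows "(\<lambda>n. pt3 (a n) 1 1) \<longlonglongrightarrow> pt3 1 0 0"
proof -
  have "continuous_on UNIV (\<lambda>s. pt3 1 s s)"
    unfolding pt3_def
    by (intro continuous_on_abs_cproj continuous_on_vector_3 continuous_intros vector_3_nonzero) auto
  then have "isCont (\<lambda>s. pt3 1 s s) 0" by (simp add: continuous_on_eq_continuous_at)
  moreover have "(\<lambda>n. inverse (a n)) \<longlonglongrightarrow> 0"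
    using assms by (rule filterlim_compose[OF tendsto_inverse_0])
  ultimately have "(\<lambda>n. pt3 1 (inverse (a n)) (inverse (a n))) \<longlonglongrightarrow> pt3 1 0 0"
    by (rule isCont_tendsto_compose)
  moreover have "\<forall>\<^sub>F n in sequentially. a n \<noteq> 0"
    using assms by (rule filterlim_at_infinity_imp_eventually_ne)
  then have "\<forall>\<^sub>F n in sequentially. pt3 1 (inverse (a n)) (inverse (a n)) = pt3 (a n) 1 1"
    by eventually_elim (subst pt3_eq_iff, auto)
  ultimately show ?thesis by (rule Lim_transform_eventually)
qed

text \<open>With \<open>y\<close> the imaginary part of the argument, the squared modulus of the
  cosine is at least \<open>(exp y - inverse (exp y))\<^sup>2 / 4\<close>, hence at least
  \<open>y\<^sup>2 / 4\<close>. Doubling the argument multiplies the last bound by 4.\<close>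

lemma cos_doubling_at_infinity:
  assumes "Im t \<noteq> 0"
  shows "filterlim (\<lambda>n. (cos (2 ^ n * t))\<^sup>2) at_infinity sequentially"
proof -
  have "\<bar>y\<bar> \<le> \<bar>exp y - inverse (exp y)\<bar>" for y :: real
  proof (cases "y \<ge> 0")
    case True
    then have "inverse (exp y) \<le> 1" by (simp add: exp_minus[symmetric])
    then show ?thesis using True exp_ge_add_one_self[of y] by linarith
  next
    case False
    then have "exp y \<le> 1" by simp
    then show ?thesis using False exp_ge_add_one_self[of "- y"] unfolding exp_minus by linarith
  qed
  then have sq: "y\<^sup>2 \<le> (exp y - inverse (exp y))\<^sup>2" for y :: real
    by (simp add: abs_le_square_iff)
  have *: "(Im t)\<^sup>2 / 4 * 4 ^ n \<le> norm ((cos (2 ^ n * t))\<^sup>2)" for n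
  proof -
    have "Im (2 ^ n * t) = Im (of_real (2 ^ n) * t)" by simp
    also have "\<dots> = 2 ^ n * Im t" unfolding times_complex.sel by simp
    finally have "(Im t)\<^sup>2 / 4 * 4 ^ n = (Im (2 ^ n * t))\<^sup>2 / 4"
      by (simp add: power_mult_distrib power_mult[symmetric] mult.commute[of n] power_mult[of 2 2 n, simplified])
    moreover have "norm ((cos (2 ^ n * t))\<^sup>2) = (cos (Re (2 ^ n * t)))\<^sup>2 +
        (exp (Im (2 ^ n * t)) - inverse (exp (Im (2 ^ n * t))))\<^sup>2 / 4"
      unfolding norm_power by (rule norm_cos_squared)
    moreover have "0 \<le> (cos (Re (2 ^ n * t)))\<^sup>2" by simp
    ultimately show ?thesis using sq[of "Im (2 ^ n * t)"] by linarith
  qed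
  have "filterlim (\<lambda>n. 4 ^ n :: real) at_top sequentially"
    by (rule filterlim_at_infinity_imp_filterlim_at_top[OF filterlim_realpow_sequentially_gt1]) auto
  then have "filterlim (\<lambda>n. (Im t)\<^sup>2 / 4 * 4 ^ n) at_top sequentially"
    using assms by (intro filterlim_tendsto_pos_mult_at_top[OF tendsto_const]) auto
  then have "filterlim (\<lambda>n. norm ((cos (2 ^ n * t))\<^sup>2)) at_top sequentially"
    by (rule filterlim_at_top_mono) (use * in auto)
  then show ?thesis by (rule filterlim_norm_at_top_imp_at_infinity)
qed

text \<open>Every \<open>z\<close> is \<open>(cos t)\<^sup>2\<close> for some complex
  \<open>t\<close>. Orbits with nonreal \<open>t\<close> escape, whereas real \<open>t\<close> gives
  exactly the values in the unit interval, whose orbits stay bounded.\<close>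

lemma fibre_1_1: "fibre 1 1 = closed_segment 0 1"
proof (intro equalityI subsetI)
  fix z :: complex assume z: "z \<in> fibre 1 1"
  define t where "t = Arccos (csqrt z)"
  have zt: "z = (cos t)\<^sup>2" by (simp add: t_def)
  have "Im t = 0"
  proof (rule ccontr)
    assume "Im t \<noteq> 0"
    then have "pt3 z 1 1 \<in> basin"
      unfolding basin_def mem_Collect_eq zt f_map_iterate_cos
      by (intro tendsto_pt3_infinity cos_doubling_at_infinity)
    then show False using z by (simp add: fibre_def julia_def)
  qed
  then have "t = of_real (Re t)" by (simp add: complex_eq_iff)
  then have "z = of_real ((cos (Re t))\<^sup>2)" unfolding zt by (metis cos_of_real of_real_power)
  then show "z \<in> closed_segment 0 1"
    by (auto simp: in_segment scaleR_conv_of_real abs_square_le_1 intro!: exI[of _ "(cos (Re t))\<^sup>2"])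
next
  fix z :: complex assume "z \<in> closed_segment 0 1"
  then obtain x where x: "0 \<le> x" "x \<le> 1" "z = of_real x"
    by (auto simp: in_segment scaleR_conv_of_real)
  define t where "t = arccos (sqrt x)"
  have "cos t = sqrt x" unfolding t_def using x real_sqrt_ge_zero[of x] by (intro cos_arccos) (linarith, simp)
  then have z: "z = (cos (of_real t))\<^sup>2" using x by (simp add: cos_of_real flip: of_real_power)
  have "norm ((cos (2 ^ n * complex_of_real t))\<^sup>2) \<le> 1" for n
  proof -
    have "(cos (2 ^ n * complex_of_real t))\<^sup>2 = of_real ((cos (2 ^ n * t))\<^sup>2)"
      by (simp add: cos_of_real[symmetric])
    then show ?thesis by (simp only: norm_of_real) (simp add: abs_square_le_1)
  qed
  then show "z \<in> fibre 1 1"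
    unfolding fibre_def mem_Collect_eq z
    by (intro not_in_basin, unfold f_map_iterate_cos)
       (rule exI, rule exI[of _ 1], rule exI[of _ 1], auto)
qed

lemma fibre_diagonal:
  assumes "c \<noteq> 0"
  shows "fibre c c = closed_segment 0 c"
proof -
  have "z \<in> fibre c c \<longleftrightarrow> z / c \<in> closed_segment 0 1" for z
  proof -
    have "pt3 z c c = pt3 (z / c) 1 1"
      using assms by (subst pt3_eq_iff) (auto intro!: exI[of _ "inverse c"] simp: field_simps)
    then show ?thesis by (simp add: fibre_def flip: fibre_1_1)
  qed
  then show ?thesis
    using assms by (auto simp: in_segment scaleR_conv_of_real field_simps)
qed

section \<open>The two implications\<close>

lemma pt2_eq_pt2_1_1_iff:
  assumes "(w, u) \<noteq> (0, 0)"
  shows "pt2 w u = pt2 1 1 \<longleftrightarrow> w = u"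
  using assms by (subst pt2_eq_iff) (auto intro!: exI[of _ "inverse u"], (metis mult_left_cancel)+)

text \<open>A homeomorphism preserves noncut points, and in the simplicial model these are among the
  finitely many vertices.\<close>

lemma finite_noncut_finite_tree:
  assumes "homeomorphic_to_finite_tree S"
  shows "connected S" "compact S" "finite (noncut S)"
proof -
  obtain K :: "(real^3) set set" where K: "simplicial_tree K" "S homeomorphic \<Union>K"
    using assms by (auto simp: homeomorphic_to_finite_tree_def)
  then obtain f g where fg: "homeomorphism (\<Union>K) S f g"
    using homeomorphic_def homeomorphic_sym by blast
  interpret graph_complex K using K(1) by unfold_locales (auto simp: simplicial_tree_def)
  have "connected (\<Union>K)" using K(1) by (intro connected_Union_K) (auto simp: simplicial_tree_def)
  then show "connected S" using K(2) homeomorphic_connectedness by blast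
  show "compact S" using K(2) compact_Union_K homeomorphic_compactness by blast
  have "g ` noncut S \<subseteq> noncut (\<Union>K)"
  proof
    fix y assume "y \<in> g ` noncut S"
    then obtain x where x: "x \<in> S" "connected (S - {x})" "y = g x" by (auto simp: noncut_def)
    have "g ` (S - {x}) = \<Union>K - {y}"
    proof -
      have "inj_on g S" "g ` S = \<Union>K" using fg by (auto simp: homeomorphism_def intro: inj_on_inverseI)
      then show ?thesis using x inj_on_image_set_diff[of g S S "{x}"] by auto
    qed
    moreover have "continuous_on (S - {x}) g"
      using fg by (auto simp: homeomorphism_def intro: continuous_on_subset)
    ultimately have "connected (\<Union>K - {y})" using x(2) connected_continuous_image by metis
    moreover have "y \<in> \<Union>K" using fg x by (auto simp: homeomorphism_def)
    ultimately show "y \<in> noncut (\<Union>K)" by (simp add: noncut_def)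
  qed
  then have "finite (g ` noncut S)"
    using noncut_simplicial_tree[OF K(1)] finite_vertices by (meson finite_subset)
  moreover have "inj_on g (noncut S)"
    using fg by (intro inj_on_inverseI[of _ f]) (auto simp: homeomorphism_def noncut_def)
  ultimately show "finite (noncut S)" by (rule finite_imageD)
qed

lemma homeomorphic_to_finite_tree_cong:
  assumes "S homeomorphic T"
  shows "homeomorphic_to_finite_tree S \<longleftrightarrow> homeomorphic_to_finite_tree T"
  unfolding homeomorphic_to_finite_tree_def
  using homeomorphic_trans[OF assms] homeomorphic_trans[OF homeomorphic_sym[THEN iffD1, OF assms]]
  by meson

lemma rtree_imp_finite_tree:
  fixes S :: "'a::real_normed_vector set"
  assumes "rtree r V S"
  shows "homeomorphic_to_finite_tree S"
  using rtree_realisation[OF assms] unfolding homeomorphic_to_finite_tree_def homeomorphic_def by blast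

text \<open>A lift of \<open>fhat\<close> to coordinate pairs. Following the pair instead of its
  class fixes the scale of each fibre, which \<open>quad\<close> depends on.\<close>

definition step :: "complex \<times> complex \<Rightarrow> complex \<times> complex" where
  "step = (\<lambda>(w, u). (quad w u, w\<^sup>2))"

lemma step_nonzero: "p \<noteq> (0, 0) \<Longrightarrow> step p \<noteq> (0, 0)"
  by (auto simp: step_def split: prod.splits)

lemma step_iterate:
  assumes "(w, u) \<noteq> (0, 0)"
  shows "(step ^^ n) (w, u) \<noteq> (0, 0) \<and>
    (fhat ^^ n) (pt2 w u) = pt2 (fst ((step ^^ n) (w, u))) (snd ((step ^^ n) (w, u)))"
proof (induction n)
  case (Suc n)
  obtain a b where ab: "(step ^^ n) (w, u) = (a, b)" by fastforce
  then show ?case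
    using Suc fhat_pt2[of a b] step_nonzero[of "(a, b)"] by (simp add: step_def)
qed (use assms in simp)

text \<open>The segment over the fixed point is pulled back along the orbit; at each stage the
  critical value \<open>0\<close> lies in the tree by \<open>mem_fibre\<close>.\<close>

lemma rtree_fibre:
  assumes "(fhat ^^ n) (pt2 w u) = pt2 1 1" "(w, u) \<noteq> (0, 0)"
  shows "\<exists>r V. rtree r V (fibre w u)"
  using assms
proof (induction n arbitrary: w u)
  case 0
  then have "w = u" "u \<noteq> 0" using pt2_eq_pt2_1_1_iff[of w u] by auto
  then show ?case
    using rtree_arc[OF arc_linepath, of 0 u] fibre_diagonal[of u] by auto
next
  case (Suc n)
  have nz: "(quad w u, w\<^sup>2) \<noteq> (0, 0)" using Suc.prems(2) by auto
  have "(fhat ^^ n) (pt2 (quad w u) (w\<^sup>2)) = pt2 1 1"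
    using Suc.prems fhat_pt2[of w u] by (simp add: funpow_swap1)
  then obtain r V where "rtree r V (fibre (quad w u) (w\<^sup>2))" using Suc.IH nz by blast
  then show ?case
    using rtree_vimage_quad mem_fibre(1)[OF nz] fibre_eq_vimage[OF Suc.prems(2)] by metis
qed

lemma finite_noncut_imp_preperiodic:
  assumes wu: "(w, u) \<noteq> (0, 0)"
    and T: "connected (fibre w u)" "compact (fibre w u)" "finite (noncut (fibre w u))"
  shows "\<exists>n. (fhat ^^ n) (pt2 w u) = pt2 1 1"
proof -
  define W where "W n = fst ((step ^^ n) (w, u))" for n
  define U where "U n = snd ((step ^^ n) (w, u))" for n
  have nz: "(W n, U n) \<noteq> (0, 0)" for n
    using step_iterate[OF wu, of n] by (simp add: W_def U_def)
  have Suc_WU: "W (Suc n) = quad (W n) (U n)" "U (Suc n) = (W n)\<^sup>2" for n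
    by (simp_all add: W_def U_def step_def case_prod_beta)
  define J where "J n = fibre (W n) (U n)" for n
  define E where "E n = noncut (J n)" for n
  have J_Suc: "J n = quad (W n) -` J (Suc n)" for n
    using fibre_eq_vimage[OF nz[of n]] unfolding J_def Suc_WU .
  have J_image: "J (Suc n) = quad (W n) ` J n" for n
  proof -
    have "\<exists>z\<in>J n. quad (W n) z = y" if "y \<in> J (Suc n)" for y
      using quad_surj[of "W n" y] that unfolding J_Suc[of n] by blast
    then show ?thesis unfolding J_Suc[of n] by blast
  qed
  have mem: "0 \<in> J n" "U n \<in> J n" "W n \<in> J n" for n
    using mem_fibre[OF nz] by (auto simp: J_def)
  have conn: "connected (J n) \<and> compact (J n)" for n
  proof (induction n)
    case 0
    then show ?case using T by (simp add: J_def W_def U_def)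
  next
    case (Suc n)
    then show ?case
      unfolding J_image by (auto intro!: connected_continuous_image compact_continuous_image continuous_intros)
  qed
  have pullback: "quad (W n) -` (E (Suc n) - {0}) \<subseteq> E n" for n
  proof
    fix z assume "z \<in> quad (W n) -` (E (Suc n) - {0})"
    then have "z \<in> noncut (quad (W n) -` J (Suc n))"
      using conn[of "Suc n"] mem(1)[of "Suc n"] by (intro noncut_vimage_quad) (auto simp: E_def)
    then show "z \<in> E n" unfolding E_def J_Suc[of n] .
  qed
  \<comment> \<open>Finiteness passes forward: every end other than \<open>0\<close> is the image of
    an end of the previous fibre.\<close>
  have fin: "finite (E n)" for n
  proof (induction n)
    case 0
    then show ?case using T by (simp add: E_def J_def W_def U_def)
  next
    case (Suc n)
    have "E (Suc n) - {0} \<subseteq> quad (W n) ` E n"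
    proof
      fix y assume y: "y \<in> E (Suc n) - {0}"
      obtain z where "quad (W n) z = y" using quad_surj by blast
      then show "y \<in> quad (W n) ` E n" using y pullback[of n] by blast
    qed
    then show ?case using Suc finite_surj[of "E n"] by (metis finite_Diff_insert finite_imageI finite_subset Diff_empty)
  qed
  have two: "2 \<le> card (E n)" for n
  proof -
    \<comment> \<open>The points \<open>0\<close>, \<open>U n\<close> and \<open>W n\<close> do not
      all coincide, since the pair is nonzero.\<close>
    have "\<exists>a b. a \<in> J n \<and> b \<in> J n \<and> a \<noteq> b" using mem[of n] nz[of n] by (metis prod.inject)
    then obtain x y where "x \<in> E n" "y \<in> E n" "x \<noteq> y"
      using two_noncut_points[of "J n"] conn[of n] unfolding E_def by metis
    then have "card {x, y} \<le> card (E n)" using fin by (intro card_mono) auto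
    then show ?thesis using \<open>x \<noteq> y\<close> by simp
  qed
  have double: "2 * card (E (Suc n) - {0}) \<le> card (E n)" for n
  proof -
    have "card (quad (W n) -` (E (Suc n) - {0})) = 2 * card (E (Suc n) - {0})"
      using fin by (intro card_vimage_quad) auto
    then show ?thesis using card_mono[OF fin pullback, of n] by linarith
  qed
  \<comment> \<open>From \<open>e n \<ge> 2 * (e (n + 1) - 1)\<close> and
    \<open>e (n + 1) \<ge> 2\<close> the count cannot grow, and equality forces both counts to be
    2.\<close>
  have dec: "card (E (Suc n)) \<le> card (E n)" "card (E (Suc n)) < card (E n) \<or> card (E n) = 2" for n
  proof -
    have "card (E (Suc n)) - 1 \<le> card (E (Suc n) - {0})"
      using fin by (simp add: card_Diff_singleton_if)
    then show "card (E (Suc n)) \<le> card (E n)" "card (E (Suc n)) < card (E n) \<or> card (E n) = 2"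
      using double[of n] two[of n] two[of "Suc n"] by linarith+
  qed
  \<comment> \<open>At an index with the least count no further drop is possible, so the count is 2
    from there on.\<close>
  obtain N where N: "\<And>n. card (E N) \<le> card (E n)"
    using ex_has_least_nat[of "\<lambda>_. True" 0 "\<lambda>n. card (E n)"] by blast
  have card2: "card (E n) = 2" if "N \<le> n" for n
    using that
  proof (induction rule: dec_induct)
    case base
    then show ?case using dec(2)[of N] N[of "Suc N"] by linarith
  next
    case (step n)
    then show ?case using dec(1)[of n] two[of "Suc n"] by linarith
  qed
  \<comment> \<open>Without \<open>0\<close>, both ends of the next fibre would pull back, giving
    four ends instead of two.\<close>
  have zero: "0 \<in> E (Suc n)" if "N \<le> n" for n
  proof (rule ccontr)
    assume "0 \<notin> E (Suc n)"
    then show False using double[of n] card2[of n] card2[of "Suc n"] that by simp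
  qed
  \<comment> \<open>The two preimages of the nonzero end \<open>y\<close> already exhaust the two
    ends one step earlier. One of these is \<open>0\<close>, so \<open>y\<close> is the image of
    \<open>0\<close>, that is \<open>(W (Suc n))\<^sup>2\<close>.\<close>
  have E_eq: "E (Suc (Suc n)) = {0, U (Suc (Suc n))} \<and> U (Suc (Suc n)) \<noteq> 0 \<and>
      quad (W (Suc n)) -` {U (Suc (Suc n))} = E (Suc n)" if n: "N \<le> n" for n
  proof -
    have "card (E (Suc (Suc n))) = 2" "0 \<in> E (Suc (Suc n))"
      using card2[of "Suc (Suc n)"] zero[of "Suc n"] n by auto
    then obtain a b where ab: "E (Suc (Suc n)) = {a, b}" "a \<noteq> b" "0 \<in> {a, b}"
      unfolding card_2_iff by metis
    obtain y where y: "E (Suc (Suc n)) = {0, y}" "y \<noteq> 0"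
    proof (cases "a = 0")
      case True
      then show thesis using ab that[of b] by simp
    next
      case False
      then show thesis using ab that[of a] by (simp add: insert_commute)
    qed
    then have "quad (W (Suc n)) -` {y} \<subseteq> E (Suc n)" using pullback[of "Suc n"] by auto
    moreover have "card (quad (W (Suc n)) -` {y}) = card (E (Suc n))"
      using card_vimage_quad(2)[of "{y}" "W (Suc n)"] y card2[of "Suc n"] n by simp
    ultimately have eq: "quad (W (Suc n)) -` {y} = E (Suc n)" using fin card_subset_eq by blast
    then have "quad (W (Suc n)) 0 = y" using zero[OF n] by blast
    then have "y = U (Suc (Suc n))" by (simp add: Suc_WU)
    then show ?thesis using y eq by simp
  qed
  \<comment> \<open>The point \<open>U\<close> is an end, so it is mapped to the next
    \<open>U\<close>; but by definition it is mapped to the next \<open>W\<close>. The two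
    coordinates therefore agree.\<close>
  have "U (Suc (Suc N)) \<in> E (Suc (Suc N))" using E_eq[of N] by simp
  moreover have "quad (W (Suc (Suc N))) -` {U (Suc (Suc (Suc N)))} = E (Suc (Suc N))"
    using E_eq[of "Suc N"] by simp
  ultimately have "quad (W (Suc (Suc N))) (U (Suc (Suc N))) = U (Suc (Suc (Suc N)))"
    by blast
  then have "W (Suc (Suc (Suc N))) = U (Suc (Suc (Suc N)))" by (simp add: Suc_WU(1)[of "Suc (Suc N)"])
  then show ?thesis
    using step_iterate[OF wu, of "Suc (Suc (Suc N))"] pt2_eq_pt2_1_1_iff[OF nz]
    unfolding W_def U_def by metis
qed

theorem proposition7p10:
  fixes w0 :: "2 cproj"
  assumes "sub_hyperbolic"
  shows "homeomorphic_to_finite_tree (julia \<inter> wline w0) \<longleftrightarrow> (\<exists>n. (fhat ^^ n) w0 = pt2 1 1)"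
proof -
  obtain w u where wu: "(w, u) \<noteq> (0, 0)" "w0 = pt2 w u" by (rule pt2_cases)
  have "homeomorphic_to_finite_tree (julia \<inter> wline w0) \<longleftrightarrow> homeomorphic_to_finite_tree (fibre w u)"
    unfolding wu(2) using julia_wline_homeomorphic_fibre[OF wu(1)]
    by (rule homeomorphic_to_finite_tree_cong)
  also have "\<dots> \<longleftrightarrow> (\<exists>n. (fhat ^^ n) w0 = pt2 1 1)"
    using finite_noncut_imp_preperiodic[OF wu(1)] finite_noncut_finite_tree
      rtree_fibre[OF _ wu(1)] rtree_imp_finite_tree unfolding wu(2) by blast
  finally show ?thesis .
qed

end
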